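(* Consider a covering problem that is efficiently $(\alpha,\gamma)$-decomposable. Given a finite set $\hat{X}$ of requests, one can compute in polynomial time a partition $\hat{X}=X_1\sqcup X_2\sqcup\dots\sqcup X_r$ together with solutions $\mathcal{S}_1,\dots,\mathcal{S}_r$, with $\mathcal{S}_i$ feasible for $X_i$, such that, writing $R_0:=\hat{X}$ and $R_i:=R_{i-1}\setminus X_i$, the following hold for each $i$ (whenever the indices involved lie in $\{1,\dots,r\}$): (A) $|X_i|\ge \frac{|\hat{X}|-(|X_1|+\dots+|X_{i-1}|)}{2}$; (B) if $c(\mathcal{S}_i)<2c(\mathcal{S}_{i-1})$, then $8c(\mathcal{S}_{i-1})<c(\mathcal{S}_{i+1})$; (C) if $c(\mathcal{S}_i)>10c(\mathcal{S}_{i-1})$, then $c(\mathcal{S}_i)\le g_{\alpha,\gamma}(|\hat{X}|)\cdot C_1$, where $C_1$ is the minimum cost of a solution covering $\lceil\frac{|\hat{X}|-(|X_1|+\dots+|X_{i-1}|)}{2}\rceil$ elements of $R_{i-1}$; (D) $c(\mathcal{S}_i)\le g_{\alpha,\gamma}(|\hat{X}|)\cdot C_2$, where for $i\ge2$, $C_2$ is the minimum cost of a solution covering $|X_i|$ elements of $R_{i-1}$, and for $i=1$, $C_2$ is the minimum cost of a solution covering $\lceil|\hat{X}|/2\rceil$ elements of $R_0$.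
   Context: A covering problem: requests, resources with nonnegative costs ($c(\mathcal{S})$ is the total cost of a resource set $\mathcal{S}$), and a feasibility relation saying which resource sets are feasible for (cover) a given set of requests, such that the union of a feasible solution for $X_1$ and a feasible solution for $X_2$ is feasible for $X_1\cup X_2$. "The minimum cost of a solution covering $j$ elements of $R$" means $\min_{A\subseteq R,|A|=j}\min\{c(\mathcal{S}):\mathcal{S}\text{ feasible for }A\}$. Efficient $(\alpha,\gamma)$-decomposability ($\alpha\ge1,\gamma\ge1$): for every instance with request set $X$ and every $i\in\{1,\dots,|X|\}$, one can compute in polynomial time $B\subseteq X$ and a solution $\mathcal{S}_B$ feasible for $B$ with $c(\mathcal{S}_B)\le\alpha\cdot$(minimum cost of a solution covering $i$ elements of $X$) and $|B|\ge i/\gamma$. Define $g_{\alpha,\gamma}(t):=\alpha$ if $\gamma=1$ and $g_{\alpha,\gamma}(t):=\alpha\left(1+\frac{\log t}{\log(\gamma/(\gamma-1))}\right)$ if $\gamma>1$.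
   Formalization: Two conditions are made explicit: a resource set feasible for X is feasible for every subset of X, and for fixed naturals a, b one can decide a·c(S) < b·c(T) in polynomial time (as for rational costs in the input); without them the claim fails. *)

theory Defs
  imports Complex_Main "HOL-Library.Extended_Nonnegative_Real" "HOL-Library.Disjoint_Sets"
begin

section \<open>Polynomial-time computation\<close>

text \<open>
  Programs compute (partial) functions on binary trees, with unbounded iteration, in the style of
  N. D. Jones' one-variable WHILE language (``Computability and Complexity'', 1997). The time
  charged is not unit cost: every step that reads, copies or tests a value is charged the size of
  that value. No value built during a run is larger than the time used so far (cf.
  \<open>eval_size_le_time\<close>), so the model and Turing machines simulate each other with polynomial overhead
  and ``polynomial time'' has its usual meaning.
\<close>

datatype tree = Leaf | Node tree tree

primrec tsize :: "tree \<Rightarrow> nat" where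
  "tsize Leaf = 1"
| "tsize (Node a b) = 1 + tsize a + tsize b"

datatype prog =
    Copy
  | Empty
  | Left
  | Right
  | Fork prog prog
  | Seq prog prog
  | Cond prog prog prog
  | While prog prog

text \<open>\<open>eval p x t y\<close>: on input \<open>x\<close> the program \<open>p\<close> halts after time \<open>t\<close> with output \<open>y\<close>. In tests,
  \<^const>\<open>Leaf\<close> means false and every other tree means true.\<close>

inductive eval :: "prog \<Rightarrow> tree \<Rightarrow> nat \<Rightarrow> tree \<Rightarrow> bool" where
  Copy: "eval Copy x (tsize x) x"
| Empty: "eval Empty x (tsize x) Leaf"
| Left_Leaf: "eval Left Leaf 1 Leaf"
| Left_Node: "eval Left (Node a b) (tsize (Node a b)) a"
| Right_Leaf: "eval Right Leaf 1 Leaf"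
| Right_Node: "eval Right (Node a b) (tsize (Node a b)) b"
| Fork: "eval p x t a \<Longrightarrow> eval q x u b \<Longrightarrow> eval (Fork p q) x (tsize x + t + u) (Node a b)"
| Seq: "eval p x t y \<Longrightarrow> eval q y u z \<Longrightarrow> eval (Seq p q) x (1 + t + u) z"
| Cond_True: "eval b x t c \<Longrightarrow> c \<noteq> Leaf \<Longrightarrow> eval p x u y \<Longrightarrow> eval (Cond b p q) x (tsize x + t + u) y"
| Cond_False: "eval b x t Leaf \<Longrightarrow> eval q x u y \<Longrightarrow> eval (Cond b p q) x (tsize x + t + u) y"
| While_True: "eval b x t c \<Longrightarrow> c \<noteq> Leaf \<Longrightarrow> eval p x u y \<Longrightarrow> eval (While b p) y v z
    \<Longrightarrow> eval (While b p) x (tsize x + t + u + v) z"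
| While_False: "eval b x t Leaf \<Longrightarrow> eval (While b p) x (tsize x + t) x"

lemma tsize_pos: "1 \<le> tsize x"
  by (cases x) auto

inductive_cases eval_CopyE: "eval Copy x t y"
inductive_cases eval_EmptyE: "eval Empty x t y"
inductive_cases eval_LeftE: "eval Left x t y"
inductive_cases eval_RightE: "eval Right x t y"
inductive_cases eval_ForkE: "eval (Fork p q) x t y"
inductive_cases eval_SeqE: "eval (Seq p q) x t y"
inductive_cases eval_CondE: "eval (Cond b p q) x t y"
inductive_cases eval_WhileE: "eval (While b p) x t y"

lemma eval_deterministic:
  "eval p x t y \<Longrightarrow> eval p x t' y' \<Longrightarrow> t = t' \<and> y = y'"
proof (induction arbitrary: t' y' rule: eval.induct)
  case (Fork p x t a q u b)
  from Fork.prems show ?case by (rule eval_ForkE) (auto dest!: Fork.IH)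
next
  case (Seq p x t y q u z)
  from Seq.prems show ?case by (rule eval_SeqE) (metis Seq.IH add.assoc plus_1_eq_Suc)
next
  case (Cond_True b x t c p u y q)
  from Cond_True.prems show ?case
    by (rule eval_CondE) (metis Cond_True.IH Cond_True.hyps)+
next
  case (Cond_False b x t q u y p)
  from Cond_False.prems show ?case
    by (rule eval_CondE) (metis Cond_False.IH)+
next
  case (While_True b x t c p u y v z)
  from While_True.prems show ?case
    by (rule eval_WhileE) (metis While_True.IH While_True.hyps)+
next
  case (While_False b x t p)
  from While_False.prems show ?case
    by (rule eval_WhileE) (metis While_False.IH)+
qed (auto elim: eval_CopyE eval_EmptyE eval_LeftE eval_RightE)

lemma eval_size_le_time: "eval p x t y \<Longrightarrow> tsize y \<le> t"
proof (induction rule: eval.induct)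
  case (Fork p x t a q u b)
  then show ?case using tsize_pos[of x] by simp
qed (use tsize_pos in auto)

text \<open>
  A search problem: instances \<open>a\<close> may have several admissible encodings \<open>x\<close> (\<open>In a x\<close>), e.g. because
  a set is listed in some order, and several correct answers \<open>y\<close> (\<open>Out a y\<close>). One program has to
  answer all instances, within a time polynomial in the size of the encoded instance.
\<close>

definition polytime_solvable :: "('a \<Rightarrow> tree \<Rightarrow> bool) \<Rightarrow> ('a \<Rightarrow> tree \<Rightarrow> bool) \<Rightarrow> bool" where
  "polytime_solvable In Out \<longleftrightarrow>
     (\<exists>p k. \<forall>a x. In a x \<longrightarrow> (\<exists>t y. eval p x t y \<and> t \<le> k * tsize x ^ k + k \<and> Out a y))"

text \<open>Encodings. A finite set is encoded by any repetition-free list of its elements. Unary numbers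
  are only used for numbers bounded by the number of requests in the same input.\<close>

primrec enc_list :: "tree list \<Rightarrow> tree" where
  "enc_list [] = Leaf"
| "enc_list (x # xs) = Node x (enc_list xs)"

primrec enc_nat :: "nat \<Rightarrow> tree" where
  "enc_nat 0 = Leaf"
| "enc_nat (Suc n) = Node Leaf (enc_nat n)"

definition enc_bool :: "bool \<Rightarrow> tree" where
  "enc_bool b = (if b then Node Leaf Leaf else Leaf)"

definition encodes_set :: "('a \<Rightarrow> tree) \<Rightarrow> 'a set \<Rightarrow> tree \<Rightarrow> bool" where
  "encodes_set e A x \<longleftrightarrow> (\<exists>xs. distinct xs \<and> set xs = A \<and> x = enc_list (map e xs))"

section \<open>Covering problems\<close>

text \<open>
  The parameter \<open>d\<close> ranges over the input data (a graph, a metric space, ...) on which requests,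
  resources, costs and feasibility may depend; an instance consists of some \<open>d\<close> and a finite set
  of requests. A problem with a single fixed ground structure is the case of a singleton \<open>data\<close>.
  The last three fields say how the objects are presented to a program.
\<close>

record ('d, 'q, 's) covering_problem =
  data :: "'d set"
  requests :: "'d \<Rightarrow> 'q set"
  resources :: "'d \<Rightarrow> 's set"
  cost :: "'d \<Rightarrow> 's \<Rightarrow> real"
  feasible :: "'d \<Rightarrow> 's set \<Rightarrow> 'q set \<Rightarrow> bool"
  enc_data :: "'d \<Rightarrow> tree"
  enc_request :: "'q \<Rightarrow> tree"
  enc_resource :: "'s \<Rightarrow> tree"

definition total_cost :: "('d, 'q, 's) covering_problem \<Rightarrow> 'd \<Rightarrow> 's set \<Rightarrow> real" where
  "total_cost \<P> d S = (\<Sum>s\<in>S. cost \<P> d s)"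

definition resource_set :: "('d, 'q, 's) covering_problem \<Rightarrow> 'd \<Rightarrow> 's set \<Rightarrow> bool" where
  "resource_set \<P> d S \<longleftrightarrow> finite S \<and> S \<subseteq> resources \<P> d"

definition request_set :: "('d, 'q, 's) covering_problem \<Rightarrow> 'd \<Rightarrow> 'q set \<Rightarrow> bool" where
  "request_set \<P> d X \<longleftrightarrow> finite X \<and> X \<subseteq> requests \<P> d"

definition solution :: "('d, 'q, 's) covering_problem \<Rightarrow> 'd \<Rightarrow> 's set \<Rightarrow> 'q set \<Rightarrow> bool" where
  "solution \<P> d S X \<longleftrightarrow> resource_set \<P> d S \<and> feasible \<P> d S X"

text \<open>
  The first clause on \<open>feasible\<close> is what it means to cover a set of requests: what covers
  \<open>X\<close> covers every part of \<open>X\<close>. The second is the union property. Supersets of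
  feasible resource sets need not be feasible.
\<close>

definition covering_problem :: "('d, 'q, 's) covering_problem \<Rightarrow> bool" where
  "covering_problem \<P> \<longleftrightarrow>
     inj_on (enc_data \<P>) (data \<P>) \<and>
     inj_on (enc_request \<P>) (\<Union>d\<in>data \<P>. requests \<P> d) \<and>
     inj_on (enc_resource \<P>) (\<Union>d\<in>data \<P>. resources \<P> d) \<and>
     (\<forall>d\<in>data \<P>.
        (\<forall>s\<in>resources \<P> d. 0 \<le> cost \<P> d s) \<and>
        (\<forall>S X Y. solution \<P> d S X \<and> request_set \<P> d X \<and> Y \<subseteq> X \<longrightarrow> feasible \<P> d S Y) \<and>
        (\<forall>S T X Y. solution \<P> d S X \<and> solution \<P> d T Y \<and> request_set \<P> d X \<and> request_set \<P> d Y
           \<longrightarrow> feasible \<P> d (S \<union> T) (X \<union> Y)))"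

text \<open>
  The minimum cost of a solution covering \<open>j\<close> elements of \<open>R\<close>; it is \<open>\<infinity>\<close> if there is no such
  solution. With finitely many resources the infimum is a minimum; in general it is one whenever
  the minimum exists.
\<close>

definition min_cost :: "('d, 'q, 's) covering_problem \<Rightarrow> 'd \<Rightarrow> 'q set \<Rightarrow> nat \<Rightarrow> ennreal" where
  "min_cost \<P> d R j =
     (INF A\<in>{A. A \<subseteq> R \<and> card A = j}. INF S\<in>{S. solution \<P> d S A}. ennreal (total_cost \<P> d S))"

text \<open>
  Costs are real numbers, so an algorithm needs some access to them: for fixed natural numbers
  \<open>a\<close> and \<open>b\<close> the inequality \<open>a * c(S) < b * c(T)\<close> can be decided in polynomial time. This holds in
  particular if the costs are rational and computable in polynomial time (e.g. listed in the input).
\<close>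

definition polytime_comparable_costs :: "('d, 'q, 's) covering_problem \<Rightarrow> bool" where
  "polytime_comparable_costs \<P> \<longleftrightarrow>
     (\<forall>a b :: nat. polytime_solvable
        (\<lambda>(d, S, T) x. d \<in> data \<P> \<and> resource_set \<P> d S \<and> resource_set \<P> d T \<and>
           (\<exists>u v. encodes_set (enc_resource \<P>) S u \<and> encodes_set (enc_resource \<P>) T v \<and>
                  x = Node (enc_data \<P> d) (Node u v)))
        (\<lambda>(d, S, T) y.
           y = enc_bool (real a * total_cost \<P> d S < real b * total_cost \<P> d T)))"

definition efficiently_decomposable ::
    "('d, 'q, 's) covering_problem \<Rightarrow> real \<Rightarrow> real \<Rightarrow> bool" where
  "efficiently_decomposable \<P> \<alpha> \<gamma> \<longleftrightarrow> 1 \<le> \<alpha> \<and> 1 \<le> \<gamma> \<and>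
     polytime_solvable
       (\<lambda>(d, X, i) x. d \<in> data \<P> \<and> request_set \<P> d X \<and> i \<in> {1..card X} \<and>
          (\<exists>u. encodes_set (enc_request \<P>) X u \<and> x = Node (enc_data \<P> d) (Node u (enc_nat i))))
       (\<lambda>(d, X, i) y. \<exists>B S u v.
          y = Node u v \<and> encodes_set (enc_request \<P>) B u \<and> encodes_set (enc_resource \<P>) S v \<and>
          B \<subseteq> X \<and> solution \<P> d S B \<and>
          ennreal (total_cost \<P> d S) \<le> ennreal \<alpha> * min_cost \<P> d X i \<and>
          real i / \<gamma> \<le> real (card B))"

definition gfun :: "real \<Rightarrow> real \<Rightarrow> real \<Rightarrow> real" where
  "gfun \<alpha> \<gamma> t = (if \<gamma> = 1 then \<alpha> else \<alpha> * (1 + ln t / ln (\<gamma> / (\<gamma> - 1))))"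

text \<open>The set \<open>R\<^sub>i\<close> of requests that remain after removing \<open>X 1, ..., X i\<close>, and half the number
  of requests outside \<open>X 1, ..., X (i - 1)\<close>.\<close>

primrec remaining :: "'q set \<Rightarrow> (nat \<Rightarrow> 'q set) \<Rightarrow> nat \<Rightarrow> 'q set" where
  "remaining Xh X 0 = Xh"
| "remaining Xh X (Suc i) = remaining Xh X i - X (Suc i)"

definition half_rest :: "'q set \<Rightarrow> (nat \<Rightarrow> 'q set) \<Rightarrow> nat \<Rightarrow> real" where
  "half_rest Xh X i = (real (card Xh) - (\<Sum>k\<in>{1..<i}. real (card (X k)))) / 2"

text \<open>The output format: the list of the pairs \<open>(X 1, S 1), ..., (X r, S r)\<close>.\<close>

definition encodes_parts ::
    "('d, 'q, 's) covering_problem \<Rightarrow> nat \<Rightarrow> (nat \<Rightarrow> 'q set) \<Rightarrow> (nat \<Rightarrow> 's set) \<Rightarrow> tree \<Rightarrow> bool" where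
  "encodes_parts \<P> r X S y \<longleftrightarrow>
     (\<exists>u v. y = enc_list (map (\<lambda>i. Node (u i) (v i)) [1..<Suc r]) \<and>
        (\<forall>i\<in>{1..r}. encodes_set (enc_request \<P>) (X i) (u i) \<and>
                     encodes_set (enc_resource \<P>) (S i) (v i)))"

definition indexed_partition :: "'q set \<Rightarrow> nat \<Rightarrow> (nat \<Rightarrow> 'q set) \<Rightarrow> bool" where
  "indexed_partition Xh r X \<longleftrightarrow>
     (\<Union>i\<in>{1..r}. X i) = Xh \<and> disjoint_family_on X {1..r} \<and> (\<forall>i\<in>{1..r}. X i \<noteq> {})"

end

theory Submission
  imports Defs "HOL-Library.While_Combinator"
begin

text \<open>
  Calling the decomposition algorithm repeatedly on the requests not yet covered, with the part of
  the demand \<open>j\<close> that is still missing, covers \<open>j\<close> requests of \<open>R\<close> at cost at most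
  \<open>g t * min_cost R j\<close> for every \<open>t \<ge> card R\<close>: each round costs at most \<open>\<alpha>\<close> times the optimum
  for \<open>j\<close> and multiplies the missing demand by at most \<open>1 - 1 / \<gamma>\<close>.

  The partition is a stack of parts. Normally one pushes a greedy cover of half of the remaining
  requests, which gives (A), (C) and (D). If the last three parts violate (B), the last two of them,
  \<open>X\<close> and \<open>Y\<close>, have total cost at most \<open>2 + 8 = 10\<close> times the cost of the third one, so (C) becomes
  vacuous for \<open>X \<union> Y\<close>. They are replaced by the cheaper of the union of their solutions and a new
  greedy cover of \<open>card (X \<union> Y)\<close> requests, and the comparison with the latter gives (D).
  Twice the number of remaining requests plus the height of the stack decreases in each step.
\<close>

section \<open>Polynomial-time functions on trees\<close>

text \<open>The decomposition algorithm may return a solution polynomially larger than its input, so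
  feeding its outputs back into it could compose polynomials without end. Every call therefore
  receives only the data, a subset of the original requests and a demand; solutions found earlier
  are stored but never passed to it. One polynomial then bounds all answers, states grow additively,
  and polynomially many rounds keep them polynomial.

  The union of two violating parts obeys the bound by ten but need not obey (D), while a fresh
  greedy cover obeys (D) but may be dear; the cheaper of them inherits both. (A) survives because
  the replacement covers at least as many requests as the lower of the two parts, out of the same
  remaining set. A cover may take more requests than demanded; minimum cost is monotone in the
  number covered, because solutions restrict to subsets, and this turns the bound for the demand
  into (D). A violation of (B) needs a predecessor, so the first part is never merged and keeps its
  bound for half of the requests.\<close>

definition poly_bound :: "(nat \<Rightarrow> nat) \<Rightarrow> bool" where
  "poly_bound f \<longleftrightarrow> mono f \<and> (\<exists>c e. \<forall>n. f n \<le> c * Suc n ^ e)"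

lemma poly_boundI: "mono f \<Longrightarrow> (\<And>n. f n \<le> c * Suc n ^ e) \<Longrightarrow> poly_bound f"
  unfolding poly_bound_def by blast

text \<open>Monotonicity belongs to the definition so that a bound on the size of an intermediate
  value can stand in for its exact size.\<close>

lemma poly_bound_mono: "poly_bound f \<Longrightarrow> m \<le> n \<Longrightarrow> f m \<le> f n"
  unfolding poly_bound_def by (auto dest: monoD)

lemma poly_bound_const: "poly_bound (\<lambda>n. c)"
  by (rule poly_boundI[where c = c and e = 0]) (auto intro: monoI)

lemma poly_bound_id: "poly_bound (\<lambda>n. n)"
  by (rule poly_boundI[where c = 1 and e = 1]) (auto intro: monoI)

lemma poly_bound_add:
  assumes "poly_bound f" "poly_bound g"
  shows "poly_bound (\<lambda>n. f n + g n)"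
proof -
  obtain c e where f: "\<And>n. f n \<le> c * Suc n ^ e" using assms(1) unfolding poly_bound_def by blast
  obtain c' e' where g: "\<And>n. g n \<le> c' * Suc n ^ e'" using assms(2) unfolding poly_bound_def by blast
  show ?thesis
  proof (rule poly_boundI[where c = "c + c'" and e = "e + e'"])
    show "mono (\<lambda>n. f n + g n)"
      by (intro monoI add_mono) (auto intro: poly_bound_mono assms)
    fix n
    have "c * Suc n ^ e \<le> c * Suc n ^ (e + e')" "c' * Suc n ^ e' \<le> c' * Suc n ^ (e + e')"
      by (intro mult_le_mono2 power_increasing; simp)+
    with f[of n] g[of n] show "f n + g n \<le> (c + c') * Suc n ^ (e + e')"
      unfolding distrib_right by linarith
  qed
qed

lemma poly_bound_mult:
  assumes "poly_bound f" "poly_bound g"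
  shows "poly_bound (\<lambda>n. f n * g n)"
proof -
  obtain c e where f: "\<And>n. f n \<le> c * Suc n ^ e" using assms(1) unfolding poly_bound_def by blast
  obtain c' e' where g: "\<And>n. g n \<le> c' * Suc n ^ e'" using assms(2) unfolding poly_bound_def by blast
  show ?thesis
  proof (rule poly_boundI[where c = "c * c'" and e = "e + e'"])
    show "mono (\<lambda>n. f n * g n)"
      by (intro monoI mult_le_mono) (auto intro: poly_bound_mono assms)
    fix n
    have "f n * g n \<le> (c * Suc n ^ e) * (c' * Suc n ^ e')"
      by (rule mult_le_mono[OF f g])
    then show "f n * g n \<le> (c * c') * Suc n ^ (e + e')"
      by (simp only: power_add mult_ac)
  qed
qed

lemma poly_bound_comp:
  assumes "poly_bound f" "poly_bound g"
  shows "poly_bound (\<lambda>n. f (g n))"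
proof -
  obtain c e where f: "\<And>n. f n \<le> c * Suc n ^ e" using assms(1) unfolding poly_bound_def by blast
  obtain c' e' where g: "\<And>n. g n \<le> c' * Suc n ^ e'" using assms(2) unfolding poly_bound_def by blast
  show ?thesis
  proof (rule poly_boundI[where c = "c * Suc c' ^ e" and e = "e' * e"])
    show "mono (\<lambda>n. f (g n))"
      by (intro monoI) (auto intro: poly_bound_mono assms)
    fix n
    have "Suc (g n) \<le> c' * Suc n ^ e' + Suc n ^ e'" using g[of n] one_le_power[of "Suc n" e'] by linarith
    then have "Suc (g n) ^ e \<le> (Suc c' * Suc n ^ e') ^ e"
      by (intro power_mono) (auto simp: algebra_simps)
    then have "c * Suc (g n) ^ e \<le> c * (Suc c' ^ e * Suc n ^ (e' * e))"
      by (intro mult_le_mono2) (simp only: power_mult power_mult_distrib)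
    then show "f (g n) \<le> (c * Suc c' ^ e) * Suc n ^ (e' * e)"
      using f[of "g n"] by (simp only: mult.assoc)
  qed
qed

lemmas poly_bound_intros =
  poly_bound_const poly_bound_id poly_bound_add poly_bound_mult

text \<open>The function is total, but the program is held to account only on \<open>D\<close>.
  Oracles behave well only on genuine encodings, so \<open>D\<close> acts as a promise that every
  caller has to establish.\<close>

definition polytime_on :: "tree set \<Rightarrow> (tree \<Rightarrow> tree) \<Rightarrow> bool" where
  "polytime_on D f \<longleftrightarrow>
     (\<exists>p T. poly_bound T \<and> (\<forall>x\<in>D. \<exists>t \<le> T (tsize x). eval p x t (f x)))"

lemma polytime_onI:
  "poly_bound T \<Longrightarrow> (\<And>x. x \<in> D \<Longrightarrow> \<exists>t \<le> T (tsize x). eval p x t (f x)) \<Longrightarrow> polytime_on D f"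
  unfolding polytime_on_def by blast

lemma polytime_onE:
  assumes "polytime_on D f"
  obtains p T where "poly_bound T" "\<And>x. x \<in> D \<Longrightarrow> \<exists>t \<le> T (tsize x). eval p x t (f x)"
  using assms unfolding polytime_on_def by blast

lemma polytime_on_size:
  assumes "polytime_on D f"
  obtains T where "poly_bound T" "\<And>x. x \<in> D \<Longrightarrow> tsize (f x) \<le> T (tsize x)"
  using assms by (elim polytime_onE) (meson eval_size_le_time le_trans)

lemma polytime_on_subset: "polytime_on E f \<Longrightarrow> D \<subseteq> E \<Longrightarrow> polytime_on D f"
  unfolding polytime_on_def by blast

text \<open>Evaluation is deterministic, so the output of a solving program is a function of its
  input. This trades the search problem for a function on trees, which can be composed
  equationally.\<close>

lemma polytime_solvable_iff:
  "polytime_solvable In Out \<longleftrightarrow>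
     (\<exists>f. polytime_on {x. \<exists>a. In a x} f \<and> (\<forall>a x. In a x \<longrightarrow> Out a (f x)))"
proof
  assume "polytime_solvable In Out"
  then obtain p k where pk: "\<And>a x. In a x \<Longrightarrow> \<exists>t y. eval p x t y \<and> t \<le> k * tsize x ^ k + k \<and> Out a y"
    unfolding polytime_solvable_def by blast
  define f where "f x = (SOME y. \<exists>t. eval p x t y)" for x
  have f: "f x = y" if "eval p x t y" for x t y
    unfolding f_def using that by (intro some_equality) (auto dest: eval_deterministic)
  have T: "poly_bound (\<lambda>n. k * n ^ k + k)"
  proof (rule poly_boundI[where c = "k + k" and e = k])
    show "mono (\<lambda>n. k * n ^ k + k)" by (intro monoI add_mono mult_le_mono2 power_mono) auto
    fix n
    have "n ^ k \<le> Suc n ^ k" "1 \<le> Suc n ^ k" by (intro power_mono) auto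
    then have "k * n ^ k \<le> k * Suc n ^ k" "k * 1 \<le> k * Suc n ^ k" by (blast intro: mult_le_mono2)+
    then show "k * n ^ k + k \<le> (k + k) * Suc n ^ k"
      unfolding distrib_right by linarith
  qed
  have "polytime_on {x. \<exists>a. In a x} f"
    by (rule polytime_onI[OF T, of _ p]) (use pk f in fastforce)
  moreover have "\<forall>a x. In a x \<longrightarrow> Out a (f x)" using pk f by blast
  ultimately show "\<exists>f. polytime_on {x. \<exists>a. In a x} f \<and> (\<forall>a x. In a x \<longrightarrow> Out a (f x))" by blast
next
  assume "\<exists>f. polytime_on {x. \<exists>a. In a x} f \<and> (\<forall>a x. In a x \<longrightarrow> Out a (f x))"
  then obtain f where f: "polytime_on {x. \<exists>a. In a x} f" "\<And>a x. In a x \<Longrightarrow> Out a (f x)" by blast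
  obtain p T where T: "poly_bound T" and
      p: "\<And>x. x \<in> {x. \<exists>a. In a x} \<Longrightarrow> \<exists>t \<le> T (tsize x). eval p x t (f x)"
    by (rule polytime_onE[OF f(1)]) blast
  obtain c e where ce: "\<And>n. T n \<le> c * Suc n ^ e" using T unfolding poly_bound_def by blast
  \<comment> \<open>For \<open>n \<ge> 1\<close>, \<open>Suc n\<close> is at most
    \<open>2 * n\<close>, which costs the factor \<open>2 ^ e\<close>; the summand \<open>e\<close>
    makes the exponent \<open>k\<close> at least \<open>e\<close>.\<close>
  define k where "k = c * 2 ^ e + e"
  have k: "T n \<le> k * n ^ k + k" if "1 \<le> n" for n
  proof -
    have "Suc n ^ e \<le> (2 * n) ^ e" using that by (intro power_mono) auto
    also have "\<dots> = 2 ^ e * n ^ e" by (rule power_mult_distrib)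
    also have "\<dots> \<le> 2 ^ e * n ^ k" using that by (intro mult_le_mono2 power_increasing) (auto simp: k_def)
    finally have "c * Suc n ^ e \<le> c * (2 ^ e * n ^ k)" by (rule mult_le_mono2)
    also have "\<dots> \<le> k * n ^ k" unfolding k_def distrib_right by (simp add: mult_ac)
    finally show ?thesis using ce[of n] by linarith
  qed
  show "polytime_solvable In Out"
    unfolding polytime_solvable_def
    using p k[OF tsize_pos] f(2) by (intro exI[of _ p] exI[of _ k]) (force intro: le_trans)
qed

section \<open>Basic operations on trees and their composition\<close>

primrec lft :: "tree \<Rightarrow> tree" where
  "lft Leaf = Leaf"
| "lft (Node a b) = a"

primrec rgt :: "tree \<Rightarrow> tree" where
  "rgt Leaf = Leaf"
| "rgt (Node a b) = b"

lemma polytime_id: "polytime_on D (\<lambda>x. x)"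
  by (rule polytime_onI[OF poly_bound_id, of _ Copy]) (auto intro: eval.Copy)

lemma polytime_Leaf: "polytime_on D (\<lambda>x. Leaf)"
  by (rule polytime_onI[OF poly_bound_id, of _ Empty]) (auto intro: eval.Empty)

text \<open>A value is never larger than the time spent on building it, so the second program runs
  on an input of size at most \<open>T n\<close>.\<close>

lemma polytime_comp:
  assumes "polytime_on E g" "polytime_on D f" "\<And>x. x \<in> D \<Longrightarrow> f x \<in> E"
  shows "polytime_on D (\<lambda>x. g (f x))"
proof -
  obtain p T where T: "poly_bound T" and p: "\<And>x. x \<in> D \<Longrightarrow> \<exists>t \<le> T (tsize x). eval p x t (f x)"
    by (rule polytime_onE[OF assms(2)]) blast
  obtain q U where U: "poly_bound U" and q: "\<And>x. x \<in> E \<Longrightarrow> \<exists>t \<le> U (tsize x). eval q x t (g x)"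
    by (rule polytime_onE[OF assms(1)]) blast
  show ?thesis
  proof (rule polytime_onI[where T = "\<lambda>n. 1 + T n + U (T n)" and p = "Seq p q"])
    show "poly_bound (\<lambda>n. 1 + T n + U (T n))"
      by (intro poly_bound_intros T poly_bound_comp[OF U])
    fix x assume x: "x \<in> D"
    obtain t where t: "t \<le> T (tsize x)" "eval p x t (f x)" using p[OF x] by blast
    obtain u where u: "u \<le> U (tsize (f x))" "eval q (f x) u (g (f x))" using q[OF assms(3)[OF x]] by blast
    have "tsize (f x) \<le> T (tsize x)" using eval_size_le_time[OF t(2)] t(1) by simp
    then have "u \<le> U (T (tsize x))" using u(1) poly_bound_mono[OF U] le_trans by blast
    then show "\<exists>t\<le>1 + T (tsize x) + U (T (tsize x)). eval (Seq p q) x t (g (f x))"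
      using t(1) eval.Seq[OF t(2) u(2)] by (intro exI[of _ "1 + t + u"]) auto
  qed
qed

lemma polytime_lft: "polytime_on D f \<Longrightarrow> polytime_on D (\<lambda>x. lft (f x))"
proof (rule polytime_comp[where E = UNIV and g = lft and f = f])
  show "polytime_on UNIV lft"
  proof (rule polytime_onI[OF poly_bound_id, of _ Left])
    show "\<exists>t\<le>tsize x. eval Left x t (lft x)" for x
      using eval.Left_Leaf eval.Left_Node by (cases x) fastforce+
  qed
qed auto

lemma polytime_rgt: "polytime_on D f \<Longrightarrow> polytime_on D (\<lambda>x. rgt (f x))"
proof (rule polytime_comp[where E = UNIV and g = rgt and f = f])
  show "polytime_on UNIV rgt"
  proof (rule polytime_onI[OF poly_bound_id, of _ Right])
    show "\<exists>t\<le>tsize x. eval Right x t (rgt x)" for x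
      using eval.Right_Leaf eval.Right_Node by (cases x) fastforce+
  qed
qed auto

lemma polytime_Node:
  assumes "polytime_on D f" "polytime_on D g"
  shows "polytime_on D (\<lambda>x. Node (f x) (g x))"
proof -
  obtain p T where T: "poly_bound T" and p: "\<And>x. x \<in> D \<Longrightarrow> \<exists>t \<le> T (tsize x). eval p x t (f x)"
    by (rule polytime_onE[OF assms(1)]) blast
  obtain q U where U: "poly_bound U" and q: "\<And>x. x \<in> D \<Longrightarrow> \<exists>t \<le> U (tsize x). eval q x t (g x)"
    by (rule polytime_onE[OF assms(2)]) blast
  show ?thesis
  proof (rule polytime_onI[where T = "\<lambda>n. n + T n + U n" and p = "Fork p q"])
    show "poly_bound (\<lambda>n. n + T n + U n)" by (intro poly_bound_intros T U)
    fix x assume x: "x \<in> D"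
    obtain t where t: "t \<le> T (tsize x)" "eval p x t (f x)" using p[OF x] by blast
    obtain u where u: "u \<le> U (tsize x)" "eval q x u (g x)" using q[OF x] by blast
    show "\<exists>t\<le>tsize x + T (tsize x) + U (tsize x). eval (Fork p q) x t (Node (f x) (g x))"
      using t(1) u(1) eval.Fork[OF t(2) u(2)] by (intro exI[of _ "tsize x + t + u"]) auto
  qed
qed

section \<open>Predicates decidable in polynomial time, branching and iteration\<close>

definition decidable_on :: "tree set \<Rightarrow> (tree \<Rightarrow> bool) \<Rightarrow> bool" where
  "decidable_on D P \<longleftrightarrow> (\<exists>f. polytime_on D f \<and> (\<forall>x\<in>D. f x \<noteq> Leaf \<longleftrightarrow> P x))"

lemma decidable_onI: "polytime_on D f \<Longrightarrow> (\<And>x. x \<in> D \<Longrightarrow> f x \<noteq> Leaf \<longleftrightarrow> P x) \<Longrightarrow> decidable_on D P"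
  unfolding decidable_on_def by blast

lemma decidable_onE:
  assumes "decidable_on D P"
  obtains f where "polytime_on D f" "\<And>x. x \<in> D \<Longrightarrow> f x \<noteq> Leaf \<longleftrightarrow> P x"
  using assms unfolding decidable_on_def by blast

lemma decidable_on_subset: "decidable_on E P \<Longrightarrow> D \<subseteq> E \<Longrightarrow> decidable_on D P"
  unfolding decidable_on_def by (meson polytime_on_subset subsetD)

text \<open>Each branch is only required to be fast where the test leads to it, so a guard can
  certify that an oracle call in its branch is admissible.\<close>

lemma polytime_if:
  assumes "decidable_on D P" "polytime_on {x \<in> D. P x} f" "polytime_on {x \<in> D. \<not> P x} g"
  shows "polytime_on D (\<lambda>x. if P x then f x else g x)"
proof -
  obtain h where h: "polytime_on D h" and P: "\<And>x. x \<in> D \<Longrightarrow> h x \<noteq> Leaf \<longleftrightarrow> P x"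
    by (rule decidable_onE[OF assms(1)]) blast
  obtain b V where V: "poly_bound V" and b: "\<And>x. x \<in> D \<Longrightarrow> \<exists>t \<le> V (tsize x). eval b x t (h x)"
    by (rule polytime_onE[OF h]) blast
  obtain p T where T: "poly_bound T"
      and p: "\<And>x. x \<in> {x \<in> D. P x} \<Longrightarrow> \<exists>t \<le> T (tsize x). eval p x t (f x)"
    by (rule polytime_onE[OF assms(2)]) blast
  obtain q U where U: "poly_bound U"
      and q: "\<And>x. x \<in> {x \<in> D. \<not> P x} \<Longrightarrow> \<exists>t \<le> U (tsize x). eval q x t (g x)"
    by (rule polytime_onE[OF assms(3)]) blast
  show ?thesis
  proof (rule polytime_onI[where T = "\<lambda>n. n + V n + (T n + U n)" and p = "Cond b p q"])
    show "poly_bound (\<lambda>n. n + V n + (T n + U n))" by (intro poly_bound_intros T U V)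
    fix x assume x: "x \<in> D"
    obtain v where v: "v \<le> V (tsize x)" "eval b x v (h x)" using b[OF x] by blast
    show "\<exists>t\<le>tsize x + V (tsize x) + (T (tsize x) + U (tsize x)).
        eval (Cond b p q) x t (if P x then f x else g x)"
    proof (cases "P x")
      case True
      obtain t where t: "t \<le> T (tsize x)" "eval p x t (f x)" using p x True by blast
      have "h x \<noteq> Leaf" using P[OF x] True by simp
      then show ?thesis using v(1) t(1) eval.Cond_True[OF v(2) _ t(2), of q] True
        by (intro exI[of _ "tsize x + v + t"]) auto
    next
      case False
      obtain t where t: "t \<le> U (tsize x)" "eval q x t (g x)" using q x False by blast
      have "h x = Leaf" using P[OF x] False by simp
      then show ?thesis using v t(1) eval.Cond_False[OF _ t(2), of b v p] False
        by (intro exI[of _ "tsize x + v + t"]) auto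
    qed
  qed
qed

lemma decidable_nonleaf: "polytime_on D f \<Longrightarrow> decidable_on D (\<lambda>x. f x \<noteq> Leaf)"
  by (rule decidable_onI) auto

lemma decidable_const: "decidable_on D (\<lambda>x. c)"
proof (cases c)
  case True
  then show ?thesis
    by (intro decidable_onI[where f = "\<lambda>x. Node Leaf Leaf"] polytime_Node polytime_Leaf) auto
next
  case False
  then show ?thesis by (intro decidable_onI[where f = "\<lambda>x. Leaf"] polytime_Leaf) auto
qed

lemma decidable_if:
  assumes "decidable_on D P" "decidable_on {x \<in> D. P x} Q" "decidable_on {x \<in> D. \<not> P x} R"
  shows "decidable_on D (\<lambda>x. if P x then Q x else R x)"
proof -
  obtain g where g: "polytime_on {x \<in> D. P x} g" "\<And>x. x \<in> {x \<in> D. P x} \<Longrightarrow> g x \<noteq> Leaf \<longleftrightarrow> Q x"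
    by (rule decidable_onE[OF assms(2)]) blast
  obtain h where h: "polytime_on {x \<in> D. \<not> P x} h" "\<And>x. x \<in> {x \<in> D. \<not> P x} \<Longrightarrow> h x \<noteq> Leaf \<longleftrightarrow> R x"
    by (rule decidable_onE[OF assms(3)]) blast
  show ?thesis
    by (rule decidable_onI[OF polytime_if[OF assms(1) g(1) h(1)]]) (use g(2) h(2) in auto)
qed

lemma decidable_conj:
  assumes "decidable_on D P" "decidable_on {x \<in> D. P x} Q"
  shows "decidable_on D (\<lambda>x. P x \<and> Q x)"
proof -
  have "decidable_on D (\<lambda>x. if P x then Q x else False)"
    by (intro decidable_if assms decidable_const)
  moreover have "(\<lambda>x. if P x then Q x else False) = (\<lambda>x. P x \<and> Q x)" by auto
  ultimately show ?thesis by simp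
qed

lemma decidable_disj:
  assumes "decidable_on D P" "decidable_on {x \<in> D. \<not> P x} Q"
  shows "decidable_on D (\<lambda>x. P x \<or> Q x)"
proof -
  have "decidable_on D (\<lambda>x. if P x then True else Q x)"
    by (intro decidable_if assms decidable_const)
  moreover have "(\<lambda>x. if P x then True else Q x) = (\<lambda>x. P x \<or> Q x)" by auto
  ultimately show ?thesis by simp
qed

lemma decidable_not:
  assumes "decidable_on D P"
  shows "decidable_on D (\<lambda>x. \<not> P x)"
proof -
  have "decidable_on D (\<lambda>x. if P x then False else True)"
    by (intro decidable_if assms decidable_const)
  moreover have "(\<lambda>x. if P x then False else True) = (\<lambda>x. \<not> P x)" by auto
  ultimately show ?thesis by simp
qed

lemma decidable_comp:
  assumes "decidable_on E P" "polytime_on D f" "\<And>x. x \<in> D \<Longrightarrow> f x \<in> E"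
  shows "decidable_on D (\<lambda>x. P (f x))"
proof -
  obtain g where g: "polytime_on E g" "\<And>x. x \<in> E \<Longrightarrow> g x \<noteq> Leaf \<longleftrightarrow> P x"
    by (rule decidable_onE[OF assms(1)]) blast
  show ?thesis by (rule decidable_onI[OF polytime_comp[OF g(1) assms(2,3)]]) (use g(2) assms(3) in auto)
qed

text \<open>
  \<open>J x s\<close> is an invariant for the states \<open>s\<close> reachable from the input \<open>x\<close>. It has to bound both
  the size of \<open>s\<close> and the number \<open>m s\<close> of further rounds polynomially in the size of \<open>x\<close>: this
  excludes repeated squaring of the state.
\<close>

lemma polytime_while:
  assumes b: "decidable_on I b" and f: "polytime_on {s \<in> I. b s} f" and P: "poly_bound P"
    and init: "\<And>x. x \<in> D \<Longrightarrow> J x x"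
    and step: "\<And>x s. x \<in> D \<Longrightarrow> J x s \<Longrightarrow> b s \<Longrightarrow> J x (f s) \<and> m (f s) < m s"
    and bound: "\<And>x s. x \<in> D \<Longrightarrow> J x s \<Longrightarrow> s \<in> I \<and> tsize s \<le> P (tsize x) \<and> m s \<le> P (tsize x)"
  shows "polytime_on D (while b f)"
proof -
  obtain h where h: "polytime_on I h" "\<And>x. x \<in> I \<Longrightarrow> h x \<noteq> Leaf \<longleftrightarrow> b x"
    by (rule decidable_onE[OF b]) blast
  obtain q V where V: "poly_bound V" and q: "\<And>x. x \<in> I \<Longrightarrow> \<exists>t \<le> V (tsize x). eval q x t (h x)"
    by (rule polytime_onE[OF h(1)]) blast
  obtain p T where T: "poly_bound T"
      and p: "\<And>x. x \<in> {s \<in> I. b s} \<Longrightarrow> \<exists>t \<le> T (tsize x). eval p x t (f x)"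
    by (rule polytime_onE[OF f]) blast
  \<comment> \<open>Bound for a single round: charge for the state, evaluation of the guard,
    execution of the body, all on states of size at most \<open>P n\<close>.\<close>
  define W where "W n = P n + V (P n) + T (P n)" for n
  have run: "\<exists>t \<le> Suc (m s) * W (tsize x). eval (While q p) s t (while b f s)"
    if "x \<in> D" "J x s" for x s
    using that(2)
  proof (induction "m s" arbitrary: s rule: less_induct)
    case less
    note s = bound[OF that(1) less.prems]
    obtain v where v: "v \<le> V (tsize s)" "eval q s v (h s)" using q s by blast
    have v': "v \<le> V (P (tsize x))" using v(1) poly_bound_mono[OF V] s le_trans by blast
    show ?case
    proof (cases "b s")
      case False
      then have "h s = Leaf" using h(2) s by blast
      then have "eval (While q p) s (tsize s + v) s" using eval.While_False v(2) by simp
      moreover have "tsize s + v \<le> Suc (m s) * W (tsize x)"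
        using s v' unfolding W_def by simp
      moreover have "while b f s = s" using False while_unfold[of b f s] by simp
      ultimately show ?thesis by metis
    next
      case True
      obtain t where t: "t \<le> T (tsize s)" "eval p s t (f s)" using p s True by blast
      have t': "t \<le> T (P (tsize x))" using t(1) poly_bound_mono[OF T] s le_trans by blast
      note st = step[OF that(1) less.prems True]
      obtain u where u: "u \<le> Suc (m (f s)) * W (tsize x)" "eval (While q p) (f s) u (while b f (f s))"
        using less.hyps st by blast
      have "h s \<noteq> Leaf" using h(2) s True by blast
      then have "eval (While q p) s (tsize s + v + t + u) (while b f s)"
        using eval.While_True[OF v(2) _ t(2) u(2)] True while_unfold[of b f s] by simp
      moreover have "tsize s + v + t + u \<le> Suc (m s) * W (tsize x)"
      proof -
        have "Suc (m (f s)) * W (tsize x) \<le> m s * W (tsize x)" using st by (intro mult_le_mono1) simp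
        moreover have "tsize s + v + t \<le> W (tsize x)" using s v' t' unfolding W_def by simp
        ultimately show ?thesis using u(1) unfolding mult_Suc by linarith
      qed
      ultimately show ?thesis by blast
    qed
  qed
  show ?thesis
  proof (rule polytime_onI[where T = "\<lambda>n. (1 + P n) * W n" and p = "While q p"])
    show "poly_bound (\<lambda>n. (1 + P n) * W n)"
      unfolding W_def by (intro poly_bound_intros P poly_bound_comp[OF V] poly_bound_comp[OF T])
    fix x assume x: "x \<in> D"
    have "Suc (m x) * W (tsize x) \<le> (1 + P (tsize x)) * W (tsize x)"
      using bound[OF x init[OF x]] by (intro mult_le_mono1) simp
    then show "\<exists>t\<le>(1 + P (tsize x)) * W (tsize x). eval (While q p) x t (while b f x)"
      using run[OF x init[OF x]] le_trans by blast
  qed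
qed

section \<open>Lists and finite sets as trees\<close>

text \<open>Every tree is the code of exactly one list, read along its right spine, so list
  functions on trees need no check of well-formedness.\<close>

primrec dec_list :: "tree \<Rightarrow> tree list" where
  "dec_list Leaf = []"
| "dec_list (Node a b) = a # dec_list b"

lemma dec_enc_list [simp]: "dec_list (enc_list xs) = xs"
  by (induction xs) auto

lemma enc_dec_list [simp]: "enc_list (dec_list t) = t"
  by (induction t) auto

lemma enc_nat_conv_list: "enc_nat n = enc_list (replicate n Leaf)"
  by (induction n) auto

lemma length_dec_list_less_tsize: "length (dec_list t) < tsize t"
  by (induction t) auto

lemma tsize_enc_list: "tsize (enc_list xs) = Suc (\<Sum>x\<leftarrow>xs. Suc (tsize x))"
  by (induction xs) auto

lemma tsize_lft: "tsize (lft x) \<le> tsize x" by (cases x) auto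
lemma tsize_rgt: "tsize (rgt x) \<le> tsize x" by (cases x) auto

text \<open>Programs can only test for \<open>Leaf\<close>. Two trees are compared with a worklist
  of pairs, where a pair of inner nodes is replaced by the two pairs of their children.\<close>

lemma decidable_eq:
  assumes f: "polytime_on D f" and g: "polytime_on D g"
  shows "decidable_on D (\<lambda>x. f x = g x)"
proof -
  \<comment> \<open>A state \<open>Node r w\<close> holds a list \<open>w\<close> of pairs still to be compared; \<open>r\<close> is \<^const>\<open>Leaf\<close> once a
    difference has been found.\<close>
  define fail where "fail p \<longleftrightarrow> (lft p = Leaf \<and> rgt p \<noteq> Leaf) \<or> (lft p \<noteq> Leaf \<and> rgt p = Leaf)" for p
  \<comment> \<open>Returning \<open>Leaf\<close> clears the flag and empties the worklist at once,
    since \<open>lft Leaf\<close> and \<open>rgt Leaf\<close> are both \<open>Leaf\<close>.\<close>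
  define F where "F s = (let p = lft (rgt s); w = rgt (rgt s) in
     if fail p then Leaf
     else if lft p = Leaf then Node (lft s) w
     else Node (lft s) (Node (Node (lft (lft p)) (lft (rgt p)))
            (Node (Node (rgt (lft p)) (rgt (rgt p))) w)))" for s
  define b where "b s \<longleftrightarrow> rgt s \<noteq> Leaf" for s
  \<comment> \<open>Left components suffice: splitting a pair removes the root of one, and
    discarding a pair removes a positive size.\<close>
  define m where "m s = (\<Sum>p\<leftarrow>dec_list (rgt s). tsize (lft p))" for s
  \<comment> \<open>Splitting trades two roots, one pair and one list cell for two pairs and two
    list cells, so the state never grows. The equivalence transports the answer from the current
    state back to the initial one.\<close>
  define J where "J x s \<longleftrightarrow> tsize s \<le> tsize x \<and>
     ((lft x \<noteq> Leaf \<and> (\<forall>p\<in>set (dec_list (rgt x)). lft p = rgt p)) \<longleftrightarrow>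
      (lft s \<noteq> Leaf \<and> (\<forall>p\<in>set (dec_list (rgt s)). lft p = rgt p)))" for x s
  have eq: "decidable_on E (\<lambda>x. h x = Leaf)" if "polytime_on E h" for E h
    using decidable_not[OF decidable_nonleaf[OF that]] by simp
  have F: "polytime_on E F" for E
    unfolding F_def Let_def fail_def
    by (intro polytime_if decidable_disj decidable_conj decidable_nonleaf eq
        polytime_Node polytime_lft polytime_rgt polytime_Leaf polytime_id)
  have b: "decidable_on E b" for E
    unfolding b_def by (intro decidable_nonleaf polytime_rgt polytime_id)
  have step: "J x (F s) \<and> m (F s) < m s" if Jb: "J x s" "b s" for x s
  proof -
    obtain r p w where s: "s = Node r (Node p w)"
      using Jb(2) unfolding b_def by (cases s; cases "rgt s") auto
    have pos: "0 < tsize (lft p)" using tsize_pos[of "lft p"] by simp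
    show ?thesis
    proof (cases "fail p")
      case True
      then have "lft p \<noteq> rgt p" unfolding fail_def by auto
      then show ?thesis using that True pos tsize_pos[of x]
        by (auto simp: J_def s F_def m_def)
    next
      case nf: False
      show ?thesis
      proof (cases "lft p = Leaf")
        case True
        then have "lft p = rgt p" using nf unfolding fail_def by auto
        then show ?thesis using that True nf pos
          by (auto simp: J_def s F_def m_def)
      next
        case False
        then obtain a1 a2 b1 b2 where p: "p = Node (Node a1 a2) (Node b1 b2)"
          using nf unfolding fail_def by (cases p; cases "lft p"; cases "rgt p") auto
        show ?thesis using that nf by (auto simp: J_def s F_def m_def p)
      qed
    qed
  qed
  have mb: "m s \<le> tsize s" for s
  proof -
    have "(\<Sum>p\<leftarrow>xs. tsize (lft p)) \<le> tsize (enc_list xs)" for xs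
      by (induction xs) (use tsize_lft in \<open>auto intro: add_mono le_SucI\<close>)
    from this[of "dec_list (rgt s)"] show ?thesis unfolding m_def using tsize_rgt[of s] by simp
  qed
  have loop: "polytime_on UNIV (while b F)"
  proof (rule polytime_while[where J = J and m = m and I = UNIV and P = "\<lambda>n. n"])
    show "s \<in> UNIV \<and> tsize s \<le> tsize x \<and> m s \<le> tsize x" if "J x s" for x s
      using that mb[of s] unfolding J_def by simp
    show "J x x" for x unfolding J_def by simp
  qed (use b F poly_bound_id step in auto)
  have res: "lft (while b F (Node (Node Leaf Leaf) (Node (Node a c) Leaf))) \<noteq> Leaf \<longleftrightarrow> a = c"
    (is "lft (while b F ?x) \<noteq> Leaf \<longleftrightarrow> _") for a c
  proof -
    have "J ?x (while b F ?x) \<and> \<not> b (while b F ?x)"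
      by (rule while_rule[where P = "J ?x" and r = "measure m"])
        (use step in \<open>auto simp: J_def[of _ ?x]\<close>)
    then show ?thesis by (auto simp: J_def b_def)
  qed
  show ?thesis
    by (rule decidable_onI[where f = "\<lambda>x. lft (while b F (Node (Node Leaf Leaf) (Node (Node (f x) (g x)) Leaf)))"])
      (use res in \<open>auto intro!: polytime_lft polytime_comp[OF loop] polytime_Node polytime_Leaf f g\<close>)
qed

text \<open>The additive growth condition on \<open>G\<close> excludes an accumulator that doubles
  with each element. The argument \<open>e\<close> is an environment that stays fixed and travels
  inside the state, because a program has a single variable.\<close>

lemma polytime_fold:
  assumes G: "polytime_on UNIV (\<lambda>z. G (lft z) (lft (rgt z)) (rgt (rgt z)))"
    and size: "\<And>e a acc. tsize (G e a acc) \<le> tsize acc + tsize a + 3"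
    and e: "polytime_on D e" and l: "polytime_on D l" and i: "polytime_on D i"
  shows "polytime_on D (\<lambda>x. fold (G (e x)) (dec_list (l x)) (i x))"
proof -
  define F where "F s = Node (lft s) (Node (rgt (lft (rgt s)))
     (G (lft s) (lft (lft (rgt s))) (rgt (rgt s))))" for s
  define b where "b s \<longleftrightarrow> lft (rgt s) \<noteq> Leaf" for s
  define m where "m s = length (dec_list (lft (rgt s)))" for s
  \<comment> \<open>Consuming \<open>a\<close> frees \<open>tsize a + 1\<close>, while the
    accumulator gains at most \<open>tsize a + 3\<close>. The net gain of 2 is paid for by the
    length, which drops by one.\<close>
  define J where "J x s \<longleftrightarrow> tsize s + 2 * m s \<le> tsize x + 2 * m x" for x s
  have m: "m s \<le> tsize s" for s
    unfolding m_def using length_dec_list_less_tsize[of "lft (rgt s)"] tsize_lft[of "rgt s"] tsize_rgt[of s]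
    by linarith
  have "polytime_on E (\<lambda>s. (\<lambda>z. G (lft z) (lft (rgt z)) (rgt (rgt z)))
      (Node (lft s) (Node (lft (lft (rgt s))) (rgt (rgt s)))))" for E
    by (rule polytime_comp[OF G])
      (intro UNIV_I polytime_Node polytime_lft polytime_rgt polytime_id)+
  then have F: "polytime_on E F" for E
    unfolding F_def by (intro polytime_Node polytime_lft polytime_rgt polytime_id) simp
  have b: "decidable_on E b" for E
    unfolding b_def by (intro decidable_nonleaf polytime_lft polytime_rgt polytime_id)
  have F_Node: "F (Node c (Node (Node a w) acc)) = Node c (Node w (G c a acc))" for c a w acc
    by (simp add: F_def)
  have step: "J x (F s) \<and> m (F s) < m s" if Jb: "J x s" "b s" for x s
  proof -
    obtain c a w acc where s: "s = Node c (Node (Node a w) acc)"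
      using Jb(2) unfolding b_def by (cases s; cases "rgt s"; cases "lft (rgt s)") auto
    show ?thesis using that(1) size[of c a acc] unfolding s F_Node by (simp add: J_def m_def)
  qed
  have loop: "polytime_on UNIV (while b F)"
  proof (rule polytime_while[where J = J and m = m and I = UNIV and P = "\<lambda>n. 3 * n"])
    show "s \<in> UNIV \<and> tsize s \<le> 3 * tsize x \<and> m s \<le> 3 * tsize x" if "J x s" for x s
      using that m[of x] m[of s] unfolding J_def by simp
    show "J x x" for x unfolding J_def by simp
  qed (use b F step in \<open>auto intro!: poly_bound_intros\<close>)
  have res: "polytime_on D (\<lambda>x. rgt (rgt (while b F (Node (e x) (Node (l x) (i x))))))"
    by (intro polytime_rgt polytime_comp[OF loop] polytime_Node e l i UNIV_I)
  have "while b F (Node c (Node w acc)) = Node c (Node Leaf (fold (G c) (dec_list w) acc))" for c w acc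
  proof (induction w arbitrary: acc)
    case Leaf
    show ?case by (subst while_unfold) (simp add: b_def)
  next
    case (Node a w)
    show ?case by (subst while_unfold) (simp add: b_def F_Node Node.IH)
  qed
  then show ?thesis using res by simp
qed

lemma decidable_mem:
  assumes f: "polytime_on D f" and l: "polytime_on D l"
  shows "decidable_on D (\<lambda>x. f x \<in> set (dec_list (l x)))"
proof (rule decidable_onI)
  show "polytime_on D (\<lambda>x. fold (\<lambda>a acc. if a = f x then Node Leaf Leaf else acc) (dec_list (l x)) Leaf)"
    by (rule polytime_fold[where G = "\<lambda>e a acc. if a = e then Node Leaf Leaf else acc"])
      (auto intro!: polytime_if decidable_eq polytime_Node polytime_lft polytime_rgt
         polytime_Leaf polytime_id f l)
  have "fold (\<lambda>a acc. if a = c then Node Leaf Leaf else acc) xs i \<noteq> Leaf \<longleftrightarrow> c \<in> set xs \<or> i \<noteq> Leaf"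
    for c :: tree and xs i
    by (induction xs arbitrary: i) auto
  then show "fold (\<lambda>a acc. if a = f x then Node Leaf Leaf else acc) (dec_list (l x)) Leaf \<noteq> Leaf
      \<longleftrightarrow> f x \<in> set (dec_list (l x))" for x
    by simp
qed

section \<open>Set operations and unary arithmetic on encoded lists\<close>

definition add_new :: "tree \<Rightarrow> tree \<Rightarrow> tree \<Rightarrow> tree" where
  "add_new e l i = fold (\<lambda>a acc. if a \<in> set (dec_list e) then acc else Node a acc) (dec_list l) i"

lemma add_new_eq: "add_new e l i = enc_list (rev (filter (\<lambda>a. a \<notin> set (dec_list e)) (dec_list l)) @ dec_list i)"
proof -
  have "fold (\<lambda>a acc. if P a then acc else Node a acc) xs i
      = enc_list (rev (filter (\<lambda>a. \<not> P a) xs) @ dec_list i)" for P xs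
    by (induction xs arbitrary: i) auto
  then show ?thesis unfolding add_new_def by simp
qed

lemma polytime_add_new:
  "polytime_on D e \<Longrightarrow> polytime_on D l \<Longrightarrow> polytime_on D i \<Longrightarrow> polytime_on D (\<lambda>x. add_new (e x) (l x) (i x))"
  unfolding add_new_def
  by (rule polytime_fold[where G = "\<lambda>e a acc. if a \<in> set (dec_list e) then acc else Node a acc"])
    (auto intro!: polytime_if decidable_mem polytime_Node polytime_lft polytime_rgt polytime_id)

text \<open>Difference, union and reversal are the same fold \<open>add_new\<close> with different
  excluded lists and start values, so a single running time argument serves all three.\<close>

definition tree_diff :: "tree \<Rightarrow> tree \<Rightarrow> tree" where
  "tree_diff u v = add_new v u Leaf"

definition tree_union :: "tree \<Rightarrow> tree \<Rightarrow> tree" where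
  "tree_union u v = add_new v u v"

definition tree_rev :: "tree \<Rightarrow> tree" where
  "tree_rev u = add_new Leaf u Leaf"

definition tree_card :: "tree \<Rightarrow> tree" where
  "tree_card u = fold (\<lambda>a acc. Node Leaf acc) (dec_list u) Leaf"

definition tree_minus :: "tree \<Rightarrow> tree \<Rightarrow> tree" where
  "tree_minus n u = fold (\<lambda>a acc. rgt acc) (dec_list u) n"

text \<open>The accumulator holds the floor and the ceiling of half the number of elements read; one
  more element turns \<open>(a, b)\<close> into \<open>(b, a + 1)\<close>. The ceiling is
  returned.\<close>

definition tree_half :: "tree \<Rightarrow> tree" where
  "tree_half u = rgt (fold (\<lambda>a acc. Node (rgt acc) (Node Leaf (lft acc))) (dec_list u) (Node Leaf Leaf))"

lemma tree_rev_eq: "tree_rev u = enc_list (rev (dec_list u))"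
  by (simp add: tree_rev_def add_new_eq)

lemma tree_card_eq: "tree_card u = enc_nat (length (dec_list u))"
proof -
  have "fold (\<lambda>a acc. Node Leaf acc) xs (enc_nat n) = enc_nat (length xs + n)" for xs :: "tree list" and n
    by (induction xs arbitrary: n) (auto simp flip: enc_nat.simps(2))
  from this[of "dec_list u" 0] show ?thesis by (simp add: tree_card_def)
qed

text \<open>Truncation at 0 comes for free because \<open>rgt Leaf\<close> is
  \<open>Leaf\<close>.\<close>

lemma tree_minus_eq: "tree_minus (enc_nat n) u = enc_nat (n - length (dec_list u))"
proof -
  have "rgt (enc_nat n) = enc_nat (n - 1)" for n by (cases n) auto
  then have "fold (\<lambda>a acc. rgt acc) xs (enc_nat n) = enc_nat (n - length xs)" for xs :: "tree list"
    by (induction xs arbitrary: n) auto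
  then show ?thesis unfolding tree_minus_def by simp
qed

lemma tree_half_eq: "tree_half u = enc_nat (Suc (length (dec_list u)) div 2)"
proof -
  have "fold (\<lambda>a acc. Node (rgt acc) (Node Leaf (lft acc))) xs (Node (enc_nat (n div 2)) (enc_nat (Suc n div 2)))
    = Node (enc_nat ((length xs + n) div 2)) (enc_nat (Suc (length xs + n) div 2))"
    for xs :: "tree list" and n
  proof (induction xs arbitrary: n)
    case (Cons x xs)
    show ?case using Cons.IH[of "Suc n"] by simp
  qed simp
  from this[of "dec_list u" 0] show ?thesis by (simp add: tree_half_def)
qed

lemma polytime_tree_diff:
  "polytime_on D f \<Longrightarrow> polytime_on D g \<Longrightarrow> polytime_on D (\<lambda>x. tree_diff (f x) (g x))"
  unfolding tree_diff_def by (intro polytime_add_new polytime_Leaf)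

lemma polytime_tree_union:
  "polytime_on D f \<Longrightarrow> polytime_on D g \<Longrightarrow> polytime_on D (\<lambda>x. tree_union (f x) (g x))"
  unfolding tree_union_def by (intro polytime_add_new)

lemma polytime_tree_rev: "polytime_on D f \<Longrightarrow> polytime_on D (\<lambda>x. tree_rev (f x))"
  unfolding tree_rev_def by (intro polytime_add_new polytime_Leaf)

lemma polytime_tree_card: "polytime_on D f \<Longrightarrow> polytime_on D (\<lambda>x. tree_card (f x))"
  unfolding tree_card_def
  by (rule polytime_fold[where G = "\<lambda>e a acc. Node Leaf acc" and e = "\<lambda>x. Leaf"])
    (auto intro!: polytime_Node polytime_rgt polytime_Leaf polytime_id)

lemma polytime_tree_minus:
  "polytime_on D f \<Longrightarrow> polytime_on D g \<Longrightarrow> polytime_on D (\<lambda>x. tree_minus (f x) (g x))"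
  unfolding tree_minus_def
  by (rule polytime_fold[where G = "\<lambda>e a acc. rgt acc" and e = "\<lambda>x. Leaf"])
    (auto intro!: polytime_rgt polytime_Leaf polytime_id le_trans[OF tsize_rgt])

lemma polytime_tree_half:
  assumes "polytime_on D f"
  shows "polytime_on D (\<lambda>x. tree_half (f x))"
  unfolding tree_half_def
proof (intro polytime_rgt
    polytime_fold[where G = "\<lambda>e a acc. Node (rgt acc) (Node Leaf (lft acc))" and e = "\<lambda>x. Leaf"])
  show "tsize (Node (rgt acc) (Node Leaf (lft acc))) \<le> tsize acc + tsize a + 3" for a acc
    using tsize_pos[of a] by (cases acc) auto
qed (intro assms polytime_Node polytime_lft polytime_rgt polytime_Leaf polytime_id)+

lemmas polytime_intros =
  polytime_Node polytime_lft polytime_rgt polytime_tree_diff polytime_tree_union polytime_tree_rev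
  polytime_tree_card polytime_tree_minus polytime_tree_half polytime_Leaf polytime_id

section \<open>Codes of finite sets\<close>

lemma encodes_set_empty [simp]: "encodes_set e {} u \<longleftrightarrow> u = Leaf"
  by (auto simp: encodes_set_def)

lemma encodes_set_Leaf [simp]: "encodes_set e A Leaf \<longleftrightarrow> A = {}"
  by (auto simp: encodes_set_def) (metis dec_enc_list dec_list.simps(1) map_is_Nil_conv)

lemma encodes_set_finite: "encodes_set e A u \<Longrightarrow> finite A"
  by (auto simp: encodes_set_def)

lemma encodes_set_card: "encodes_set e A u \<Longrightarrow> length (dec_list u) = card A"
  by (auto simp: encodes_set_def distinct_card)

text \<open>The size of a code depends on the set alone and not on the order of listing. Hence
  subsets have codes that are no larger, in whatever order an algorithm happens to list
  them.\<close>

lemma encodes_set_tsize: "encodes_set e A u \<Longrightarrow> tsize u = Suc (\<Sum>a\<in>A. Suc (tsize (e a)))"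
  by (auto simp: encodes_set_def tsize_enc_list sum_list_distinct_conv_sum_set o_def)

lemma encodes_set_tsize_mono:
  "encodes_set e A u \<Longrightarrow> encodes_set e B v \<Longrightarrow> A \<subseteq> B \<Longrightarrow> tsize u \<le> tsize v"
  by (auto simp: encodes_set_tsize intro: sum_mono2 encodes_set_finite)

text \<open>Injectivity on \<open>A \<union> B\<close> makes membership of codes agree with
  membership of elements; \<open>A \<inter> C \<subseteq> B\<close> keeps the resulting list free of
  repetitions.\<close>

lemma encodes_set_add_new:
  assumes A: "encodes_set e A u" and B: "encodes_set e B v" and C: "encodes_set e C w"
    and inj: "inj_on e (A \<union> B)" and disj: "A \<inter> C \<subseteq> B"
  shows "encodes_set e ((A - B) \<union> C) (add_new v u w)"
proof -
  obtain xs where xs: "distinct xs" "set xs = A" "u = enc_list (map e xs)"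
    using A unfolding encodes_set_def by blast
  obtain ys where ys: "set ys = B" "v = enc_list (map e ys)"
    using B unfolding encodes_set_def by blast
  obtain zs where zs: "distinct zs" "set zs = C" "w = enc_list (map e zs)"
    using C unfolding encodes_set_def by blast
  have "filter (\<lambda>a. a \<notin> set (map e ys)) (map e xs) = map e (filter (\<lambda>a. a \<notin> B) xs)"
    unfolding filter_map o_def using inj xs(2) ys(1)
    by (intro arg_cong[where f = "map e"] filter_cong) (auto simp: inj_on_def)
  then have "add_new v u w = enc_list (map e (rev (filter (\<lambda>a. a \<notin> B) xs) @ zs))"
    unfolding add_new_eq xs(3) ys(2) zs(3) by (simp add: rev_map)
  then show ?thesis
    unfolding encodes_set_def using xs(1,2) zs(1,2) disj
    by (intro exI[of _ "rev (filter (\<lambda>a. a \<notin> B) xs) @ zs"]) auto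
qed

lemma encodes_set_diff:
  "encodes_set e A u \<Longrightarrow> encodes_set e B v \<Longrightarrow> inj_on e (A \<union> B) \<Longrightarrow> encodes_set e (A - B) (tree_diff u v)"
  using encodes_set_add_new[of e A u B v "{}" Leaf] by (simp add: tree_diff_def)

lemma encodes_set_union:
  "encodes_set e A u \<Longrightarrow> encodes_set e B v \<Longrightarrow> inj_on e (A \<union> B) \<Longrightarrow> encodes_set e (A \<union> B) (tree_union u v)"
  using encodes_set_add_new[of e A u B v B v] by (simp add: tree_union_def)

lemma encodes_set_tsize_union:
  assumes "encodes_set e A u" "encodes_set e B v" "encodes_set e (A \<union> B) w"
  shows "tsize w \<le> tsize u + tsize v"
proof -
  have "(\<Sum>a\<in>A \<union> B. Suc (tsize (e a))) \<le> (\<Sum>a\<in>A. Suc (tsize (e a))) + (\<Sum>a\<in>B. Suc (tsize (e a)))"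
    using assms(1,2) by (intro sum_Un_nat[THEN ord_eq_le_trans] ) (auto intro: encodes_set_finite)
  then show ?thesis using assms by (simp add: encodes_set_tsize)
qed

section \<open>Greedy covering of a prescribed number of requests\<close>

text \<open>Each set competing on the right contains one competing on the left, and every solution
  for the former also serves the latter at the same cost.\<close>

lemma min_cost_mono:
  assumes "\<And>A. A \<subseteq> R \<Longrightarrow> card A = j \<Longrightarrow> \<exists>A'\<subseteq>A. A' \<subseteq> R' \<and> card A' = j'"
    and "\<And>A A' S. A \<subseteq> R \<Longrightarrow> A' \<subseteq> A \<Longrightarrow> solution \<P> d S A \<Longrightarrow> solution \<P> d S A'"
  shows "min_cost \<P> d R' j' \<le> min_cost \<P> d R j"
  unfolding min_cost_def
proof (intro INF_greatest)
  fix A S assume A: "A \<in> {A. A \<subseteq> R \<and> card A = j}" and S: "S \<in> {S. solution \<P> d S A}"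
  then obtain A' where A': "A' \<subseteq> A" "A' \<subseteq> R'" "card A' = j'" using assms(1)[of A] by blast
  then have "solution \<P> d S A'" using assms(2) A S by blast
  with A' show "(INF A\<in>{A. A \<subseteq> R' \<and> card A = j'}. INF S\<in>{S. solution \<P> d S A}. ennreal (total_cost \<P> d S))
      \<le> ennreal (total_cost \<P> d S)"
    by (intro INF_lower2[of A'] INF_lower) auto
qed

lemma gfun_nonneg: "1 \<le> \<alpha> \<Longrightarrow> 1 \<le> \<gamma> \<Longrightarrow> 1 \<le> N \<Longrightarrow> 0 \<le> gfun \<alpha> \<gamma> N"
  unfolding gfun_def by (auto intro!: mult_nonneg_nonneg add_nonneg_nonneg divide_nonneg_nonneg)

text \<open>If the demand shrinks by the factor \<open>1 - 1 / \<gamma>\<close> in each of \<open>k\<close> rounds and is still at least 1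
  before the last one, then \<open>k\<close> is at most logarithmic.\<close>

lemma rounds_le_gfun:
  fixes j :: real
  assumes \<alpha>: "1 \<le> \<alpha>" and \<gamma>: "1 \<le> \<gamma>" and j: "1 \<le> j" "j \<le> N"
    and k: "k = 0 \<or> 1 \<le> j * (1 - 1 / \<gamma>) ^ (k - 1)"
  shows "real k * \<alpha> \<le> gfun \<alpha> \<gamma> N"
proof (cases "k = 0")
  case True
  then show ?thesis using gfun_nonneg[OF \<alpha> \<gamma>, of N] j by simp
next
  case False
  then have k1: "1 \<le> j * (1 - 1 / \<gamma>) ^ (k - 1)" using k by simp
  show ?thesis
  proof (cases "\<gamma> = 1")
    case True
    \<comment> \<open>The shrinking factor is 0, so a positive exponent would make the demand before
      the last round vanish: there is just one round.\<close>
    then have "k - 1 = 0" using k1 by (cases "k - 1") auto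
    then show ?thesis using True False \<alpha> by (simp add: gfun_def)
  next
    case \<gamma>1: False
    \<comment> \<open>The inverse of the shrinking factor \<open>1 - 1 / \<gamma>\<close>, which is
      the base of the logarithm in \<open>gfun\<close>.\<close>
    define q where "q = \<gamma> / (\<gamma> - 1)"
    have q: "1 < q" using \<gamma> \<gamma>1 unfolding q_def by (simp add: field_simps)
    have "1 - 1 / \<gamma> = 1 / q" using \<gamma> \<gamma>1 unfolding q_def by (simp add: field_simps)
    then have "1 \<le> j * (1 / q) ^ (k - 1)" using k1 by metis
    then have "q ^ (k - 1) \<le> j" using q by (simp add: power_divide le_divide_eq)
    also note j(2)
    finally have "ln (q ^ (k - 1)) \<le> ln N" using q j by (intro ln_mono) auto
    then have "real (k - 1) \<le> ln N / ln q" using q by (simp add: ln_realpow field_simps)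
    then have "real k \<le> 1 + ln N / ln q" using False by simp
    then have "\<alpha> * real k \<le> \<alpha> * (1 + ln N / ln q)" using \<alpha> by (intro mult_left_mono) auto
    then show ?thesis using \<gamma>1 unfolding gfun_def q_def by (simp add: mult.commute)
  qed
qed

abbreviation demand_inputs :: "('d, 'q, 's) covering_problem \<Rightarrow> tree set" where
  "demand_inputs \<P> \<equiv> {x. \<exists>d X i u. d \<in> data \<P> \<and> request_set \<P> d X \<and> i \<in> {1..card X} \<and>
     encodes_set (enc_request \<P>) X u \<and> x = Node (enc_data \<P> d) (Node u (enc_nat i))}"

abbreviation comparison_inputs :: "('d, 'q, 's) covering_problem \<Rightarrow> tree set" where
  "comparison_inputs \<P> \<equiv> {x. \<exists>d S S' u v. d \<in> data \<P> \<and> resource_set \<P> d S \<and>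
     resource_set \<P> d S' \<and> encodes_set (enc_resource \<P>) S u \<and>
     encodes_set (enc_resource \<P>) S' v \<and> x = Node (enc_data \<P> d) (Node u v)}"

text \<open>The two given algorithms as functions on trees: \<open>F\<close> decomposes,
  \<open>K a b\<close> compares multiples of costs. The output size of \<open>F\<close> gets its own
  bound \<open>T\<close> because it governs how fast accumulated solutions grow.\<close>

locale covering_algorithm =
  fixes \<P> :: "('d, 'q, 's) covering_problem" and \<alpha> \<gamma> :: real
    and F :: "tree \<Rightarrow> tree" and T :: "nat \<Rightarrow> nat" and K :: "nat \<Rightarrow> nat \<Rightarrow> tree \<Rightarrow> tree"
  assumes covering: "covering_problem \<P>" and \<alpha>: "1 \<le> \<alpha>" and \<gamma>: "1 \<le> \<gamma>"
    and poly_F: "polytime_on (demand_inputs \<P>) F"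
    and F: "\<And>d X i u. d \<in> data \<P> \<Longrightarrow> request_set \<P> d X \<Longrightarrow> i \<in> {1..card X} \<Longrightarrow>
          encodes_set (enc_request \<P>) X u \<Longrightarrow>
          \<exists>B S v w. F (Node (enc_data \<P> d) (Node u (enc_nat i))) = Node v w \<and>
            encodes_set (enc_request \<P>) B v \<and> encodes_set (enc_resource \<P>) S w \<and>
            B \<subseteq> X \<and> solution \<P> d S B \<and>
            ennreal (total_cost \<P> d S) \<le> ennreal \<alpha> * min_cost \<P> d X i \<and>
            real i / \<gamma> \<le> real (card B)"
    and T: "poly_bound T"
    and size_F: "\<And>d X i u. d \<in> data \<P> \<Longrightarrow> request_set \<P> d X \<Longrightarrow> i \<in> {1..card X} \<Longrightarrow>
          encodes_set (enc_request \<P>) X u \<Longrightarrow>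
          tsize (F (Node (enc_data \<P> d) (Node u (enc_nat i))))
            \<le> T (tsize (Node (enc_data \<P> d) (Node u (enc_nat i))))"
    and poly_K: "\<And>a b. polytime_on (comparison_inputs \<P>) (K a b)"
    and K: "\<And>a b d S S' u v. d \<in> data \<P> \<Longrightarrow> resource_set \<P> d S \<Longrightarrow> resource_set \<P> d S' \<Longrightarrow>
          encodes_set (enc_resource \<P>) S u \<Longrightarrow> encodes_set (enc_resource \<P>) S' v \<Longrightarrow>
          K a b (Node (enc_data \<P> d) (Node u v)) \<noteq> Leaf \<longleftrightarrow>
            real a * total_cost \<P> d S < real b * total_cost \<P> d S'"
begin

lemma solution_subset:
  "d \<in> data \<P> \<Longrightarrow> request_set \<P> d X \<Longrightarrow> solution \<P> d S X \<Longrightarrow> Y \<subseteq> X \<Longrightarrow> solution \<P> d S Y"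
  using covering unfolding covering_problem_def solution_def by blast

lemma solution_union:
  assumes "d \<in> data \<P>" "request_set \<P> d X" "request_set \<P> d Y" "solution \<P> d S X" "solution \<P> d S' Y"
  shows "solution \<P> d (S \<union> S') (X \<union> Y)"
proof -
  have "feasible \<P> d (S \<union> S') (X \<union> Y)" using covering assms unfolding covering_problem_def by blast
  then show ?thesis using assms(4,5) by (auto simp: solution_def resource_set_def)
qed

lemma cost_nonneg: "d \<in> data \<P> \<Longrightarrow> resource_set \<P> d S \<Longrightarrow> s \<in> S \<Longrightarrow> 0 \<le> cost \<P> d s"
  using covering unfolding covering_problem_def resource_set_def by blast

lemma total_cost_nonneg: "d \<in> data \<P> \<Longrightarrow> resource_set \<P> d S \<Longrightarrow> 0 \<le> total_cost \<P> d S"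
  unfolding total_cost_def by (intro sum_nonneg cost_nonneg)

lemma total_cost_union:
  assumes "d \<in> data \<P>" "resource_set \<P> d S" "resource_set \<P> d S'"
  shows "total_cost \<P> d (S \<union> S') \<le> total_cost \<P> d S + total_cost \<P> d S'"
proof -
  have "total_cost \<P> d (S \<union> S') + (\<Sum>s\<in>S \<inter> S'. cost \<P> d s) = total_cost \<P> d S + total_cost \<P> d S'"
    unfolding total_cost_def using assms by (intro sum.union_inter) (auto simp: resource_set_def)
  moreover have "0 \<le> (\<Sum>s\<in>S \<inter> S'. cost \<P> d s)"
    using assms by (intro sum_nonneg) (auto intro: cost_nonneg)
  ultimately show ?thesis by simp
qed

lemma min_cost_le:
  assumes d: "d \<in> data \<P>" and R: "request_set \<P> d R"
    and "\<And>A. A \<subseteq> R \<Longrightarrow> card A = j \<Longrightarrow> \<exists>A'\<subseteq>A. A' \<subseteq> R' \<and> card A' = j'"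
  shows "min_cost \<P> d R' j' \<le> min_cost \<P> d R j"
proof (rule min_cost_mono[OF assms(3)])
  fix A A' S assume "A \<subseteq> R" "A' \<subseteq> A" "solution \<P> d S A"
  moreover have "request_set \<P> d A"
    using R \<open>A \<subseteq> R\<close> unfolding request_set_def by (auto intro: finite_subset)
  ultimately show "solution \<P> d S A'" using solution_subset d by blast
qed auto

text \<open>A set of \<open>j\<close> requests loses at most \<open>card B\<close> of them when
  \<open>B\<close> is removed. Every greedy round can therefore be charged to the optimum of the
  original demand.\<close>

lemma min_cost_diff:
  assumes d: "d \<in> data \<P>" and X: "request_set \<P> d X" and "B \<subseteq> X" "n = j - card B"
  shows "min_cost \<P> d (X - B) n \<le> min_cost \<P> d X j"
proof (rule min_cost_le[OF d X])
  fix A assume A: "A \<subseteq> X" "card A = j"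
  have "finite A" "finite B" using X A assms(3) unfolding request_set_def by (auto intro: finite_subset)
  then have "n \<le> card (A - B)" using A(2) assms(4) diff_card_le_card_Diff[of B A] by linarith
  then obtain A' where "A' \<subseteq> A - B" "card A' = n" by (rule obtain_subset_with_card_n)
  then show "\<exists>A'\<subseteq>A. A' \<subseteq> X - B \<and> card A' = n" using A(1) by blast
qed

text \<open>Passes from the requested number of requests to the number really covered, which may be
  larger.\<close>

lemma min_cost_mono_card:
  assumes "d \<in> data \<P>" "request_set \<P> d X" "i \<le> j"
  shows "min_cost \<P> d X i \<le> min_cost \<P> d X j"
proof (rule min_cost_le[OF assms(1,2)])
  fix A assume "A \<subseteq> X" "card A = j"
  then obtain A' where "A' \<subseteq> A" "card A' = i" using assms(3) obtain_subset_with_card_n[of i A] by metis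
  then show "\<exists>A'\<subseteq>A. A' \<subseteq> X \<and> card A' = i" using \<open>A \<subseteq> X\<close> by blast
qed

lemma inj_request: "d \<in> data \<P> \<Longrightarrow> A \<subseteq> requests \<P> d \<Longrightarrow> inj_on (enc_request \<P>) A"
  using covering unfolding covering_problem_def by (elim conjE) (erule inj_on_subset, blast)

lemma inj_resource: "d \<in> data \<P> \<Longrightarrow> A \<subseteq> resources \<P> d \<Longrightarrow> inj_on (enc_resource \<P>) A"
  using covering unfolding covering_problem_def by (elim conjE) (erule inj_on_subset, blast)

section \<open>The greedy loop and its invariant\<close>

definition greedy_step :: "tree \<Rightarrow> tree" where
  "greedy_step s = (let d = lft s; R = lft (rgt s); n = lft (rgt (rgt s));
      B = lft (rgt (rgt (rgt s))); S = rgt (rgt (rgt (rgt s)));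
      y = F (Node d (Node R n))
    in Node d (Node (tree_diff R (lft y)) (Node (tree_minus n (lft y))
         (Node (tree_union (lft y) B) (tree_union (rgt y) S)))))"

definition greedy_start :: "tree \<Rightarrow> tree \<Rightarrow> tree \<Rightarrow> tree" where
  "greedy_start d R n = Node d (Node R (Node n (Node Leaf Leaf)))"

definition greedy :: "tree \<Rightarrow> tree \<Rightarrow> tree \<Rightarrow> tree" where
  "greedy d R n = rgt (rgt (rgt (while (\<lambda>s. lft (rgt (rgt s)) \<noteq> Leaf) greedy_step (greedy_start d R n))))"

text \<open>Here \<open>k\<close> counts the rounds. The empty resource set is not assumed to be
  feasible for the empty request set, so before the first round \<open>S\<close> is not claimed to
  be a solution. The clause with exponent \<open>k - 1\<close> says that the demand before the last
  round was at least 1. In the last clause \<open>n * T (tsize x)\<close> is the budget left for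
  resources: a round adds at most \<open>T (tsize x)\<close> and lowers \<open>n\<close> by at least
  one.\<close>

definition greedy_inv :: "'d \<Rightarrow> 'q set \<Rightarrow> tree \<Rightarrow> nat \<Rightarrow> tree \<Rightarrow> bool" where
  "greedy_inv d X x j s \<longleftrightarrow> (\<exists>B S n k ru bu su.
     s = Node (enc_data \<P> d) (Node ru (Node (enc_nat n) (Node bu su))) \<and>
     encodes_set (enc_request \<P>) (X - B) ru \<and> encodes_set (enc_request \<P>) B bu \<and>
     encodes_set (enc_resource \<P>) S su \<and> B \<subseteq> X \<and>
     (if B = {} then S = {} else solution \<P> d S B) \<and> n = j - card B \<and>
     ennreal (total_cost \<P> d S) \<le> ennreal (real k * \<alpha>) * min_cost \<P> d X j \<and>
     real n \<le> real j * (1 - 1 / \<gamma>) ^ k \<and> (k = 0 \<or> 1 \<le> real j * (1 - 1 / \<gamma>) ^ (k - 1)) \<and>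
     tsize su + n * T (tsize x) \<le> Suc (j * T (tsize x)))"

lemma greedy_inv_start:
  assumes "encodes_set (enc_request \<P>) X u"
  shows "greedy_inv d X x j (greedy_start (enc_data \<P> d) u (enc_nat j))"
  unfolding greedy_inv_def greedy_start_def
  by (rule exI[of _ "{}"], rule exI[of _ "{}"], rule exI[of _ j], rule exI[of _ 0],
      rule exI[of _ u], rule exI[of _ Leaf], rule exI[of _ Leaf])
    (use assms in \<open>simp add: total_cost_def\<close>)

lemma tsize_enc_nat: "tsize (enc_nat n) = 2 * n + 1"
  by (induction n) auto

lemma enc_nat_eq_Leaf: "enc_nat n = Leaf \<longleftrightarrow> n = 0"
  by (cases n) auto

context
  fixes d X u j x
  assumes d: "d \<in> data \<P>" and X: "request_set \<P> d X" and u: "encodes_set (enc_request \<P>) X u"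
    and j: "j \<in> {1..card X}"
    and x: "x = greedy_start (enc_data \<P> d) u (enc_nat j)"
begin

text \<open>The second conclusion certifies that the call of \<open>F\<close> is made on a genuine
  instance; the running time proof needs it separately.\<close>

lemma greedy_inv_step:
  assumes inv: "greedy_inv d X x j s" and more: "lft (rgt (rgt s)) \<noteq> Leaf"
  shows "greedy_inv d X x j (greedy_step s) \<and>
    length (dec_list (lft (rgt (rgt (greedy_step s))))) < length (dec_list (lft (rgt (rgt s))))"
    and "\<exists>d X i u. d \<in> data \<P> \<and> request_set \<P> d X \<and> i \<in> {1..card X} \<and>
      encodes_set (enc_request \<P>) X u \<and>
      Node (lft s) (Node (lft (rgt s)) (lft (rgt (rgt s)))) = Node (enc_data \<P> d) (Node u (enc_nat i))"
proof -
  obtain B S n k ru bu su where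
    s: "s = Node (enc_data \<P> d) (Node ru (Node (enc_nat n) (Node bu su)))" and
    ru: "encodes_set (enc_request \<P>) (X - B) ru" and bu: "encodes_set (enc_request \<P>) B bu" and
    su: "encodes_set (enc_resource \<P>) S su" and B: "B \<subseteq> X" and
    S: "if B = {} then S = {} else solution \<P> d S B" and n: "n = j - card B" and
    cost: "ennreal (total_cost \<P> d S) \<le> ennreal (real k * \<alpha>) * min_cost \<P> d X j" and
    nk: "real n \<le> real j * (1 - 1 / \<gamma>) ^ k" and
    size: "tsize su + n * T (tsize x) \<le> Suc (j * T (tsize x))"
    using inv unfolding greedy_inv_def by blast
  have n1: "1 \<le> n" using more by (cases n) (auto simp: s)
  have fin: "finite X" "finite B" using X B unfolding request_set_def by (auto intro: finite_subset)
  have XB: "request_set \<P> d (X - B)" using X unfolding request_set_def by auto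
  \<comment> \<open>The missing demand can still be met, since \<open>n = j - card B\<close> and
    \<open>j \<le> card X\<close>.\<close>
  have nXB: "n \<in> {1..card (X - B)}" using n n1 j card_Diff_subset[OF fin(2) B] by auto
  obtain B' S' v w where y: "F (Node (enc_data \<P> d) (Node ru (enc_nat n))) = Node v w"
    and v: "encodes_set (enc_request \<P>) B' v" and w: "encodes_set (enc_resource \<P>) S' w"
    and B': "B' \<subseteq> X - B" and S': "solution \<P> d S' B'"
    and cost': "ennreal (total_cost \<P> d S') \<le> ennreal \<alpha> * min_cost \<P> d (X - B) n"
    and card': "real n / \<gamma> \<le> real (card B')"
    using F[OF d XB nXB ru] by blast
  \<comment> \<open>A positive demand divided by \<open>\<gamma>\<close> is positive, so at least
    one request gets covered. This progress holds for every \<open>\<gamma>\<close>.\<close>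
  have card1: "1 \<le> card B'"
  proof -
    have "0 < real n / \<gamma>" using n1 \<gamma> by simp
    then show ?thesis using card' by linarith
  qed
  have fin': "finite B'" using card1 by (metis card.infinite not_one_le_zero)
  have reqs: "request_set \<P> d B" "request_set \<P> d B'"
    using X B B' fin fin' unfolding request_set_def by auto
  have res: "resource_set \<P> d S" "resource_set \<P> d S'"
    using S S' by (auto simp: solution_def resource_set_def split: if_splits)
  define n' where "n' = n - card B'"
  have step: "greedy_step s = Node (enc_data \<P> d) (Node (tree_diff ru v) (Node (enc_nat n')
      (Node (tree_union v bu) (tree_union w su))))"
    unfolding greedy_step_def Let_def s
    by (simp add: y tree_minus_eq encodes_set_card[OF v] n'_def)
  have "B' \<noteq> {}" using card1 by auto
  have sol: "solution \<P> d (S' \<union> S) (B' \<union> B)"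
    using S S' solution_union[OF d reqs(2,1) S'] by (cases "B = {}") auto
  have n'_eq: "n' = j - card (B' \<union> B)"
    unfolding n'_def n using B' fin fin' by (subst card_Un_disjoint) auto
  have "ennreal (total_cost \<P> d (S' \<union> S)) \<le> ennreal (total_cost \<P> d S + total_cost \<P> d S')"
    using total_cost_union[OF d res(2,1)] by (intro ennreal_leI) simp
  also have "\<dots> = ennreal (total_cost \<P> d S) + ennreal (total_cost \<P> d S')"
    using total_cost_nonneg[OF d] res by (intro ennreal_plus) auto
  \<comment> \<open>The new round is charged to the same optimum as the earlier ones, by
    \<open>min_cost_diff\<close>.\<close>
  also have "\<dots> \<le> ennreal (real k * \<alpha>) * min_cost \<P> d X j + ennreal \<alpha> * min_cost \<P> d X j"
    using cost order_trans[OF cost' mult_left_mono[OF min_cost_diff[OF d X B n]]]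
    by (intro add_mono) auto
  also have "\<dots> = ennreal (real k * \<alpha> + \<alpha>) * min_cost \<P> d X j"
    using \<alpha> by (subst ennreal_plus) (auto simp: distrib_right)
  also have "real k * \<alpha> + \<alpha> = real (Suc k) * \<alpha>" by (simp add: algebra_simps)
  finally have cost2: "ennreal (total_cost \<P> d (S' \<union> S)) \<le> ennreal (real (Suc k) * \<alpha>) * min_cost \<P> d X j" .
  have nk': "real n' \<le> real j * (1 - 1 / \<gamma>) ^ Suc k"
  proof -
    have q: "0 \<le> 1 - 1 / \<gamma>" using \<gamma> by simp
    \<comment> \<open>If the round covers more than demanded, the truncated difference is 0;
      otherwise at least \<open>n / \<gamma>\<close> is subtracted.\<close>
    have "real n' \<le> real n * (1 - 1 / \<gamma>)"
    proof (cases "card B' \<le> n")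
      case True
      then show ?thesis using card' unfolding n'_def by (simp add: of_nat_diff algebra_simps)
    qed (use q in \<open>simp add: n'_def\<close>)
    also have "\<dots> \<le> (real j * (1 - 1 / \<gamma>) ^ k) * (1 - 1 / \<gamma>)" by (intro mult_right_mono nk q)
    finally show ?thesis by (simp add: mult_ac)
  qed
  have n'_less: "n' < n" unfolding n'_def using card1 n1 by simp
  have un: "encodes_set (enc_resource \<P>) (S' \<union> S) (tree_union w su)"
    using res by (intro encodes_set_union w su inj_resource[OF d]) (auto simp: resource_set_def)
  have size': "tsize (tree_union w su) + n' * T (tsize x) \<le> Suc (j * T (tsize x))"
  proof -
    have "tsize ru \<le> tsize u" using encodes_set_tsize_mono[OF ru u] by blast
    then have "tsize (Node (enc_data \<P> d) (Node ru (enc_nat n))) \<le> tsize x"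
      using n unfolding x greedy_start_def by (simp add: tsize_enc_nat)
    then have "tsize (Node v w) \<le> T (tsize x)"
      using size_F[OF d XB nXB ru] poly_bound_mono[OF T] le_trans unfolding y by blast
    then have "tsize w \<le> T (tsize x)" by simp
    moreover have "n' * T (tsize x) + T (tsize x) \<le> n * T (tsize x)"
      using mult_le_mono1[of "Suc n'" n "T (tsize x)"] n'_less by simp
    ultimately show ?thesis using size encodes_set_tsize_union[OF w su un] by linarith
  qed
  have rest: "encodes_set (enc_request \<P>) (X - (B' \<union> B)) (tree_diff ru v)"
  proof -
    have "X - (B' \<union> B) = (X - B) - B'" by blast
    moreover have "inj_on (enc_request \<P>) (X - B \<union> B')"
      using X B' by (intro inj_request[OF d]) (auto simp: request_set_def)
    ultimately show ?thesis using encodes_set_diff[OF ru v] by simp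
  qed
  have covered: "encodes_set (enc_request \<P>) (B' \<union> B) (tree_union v bu)"
    using X B B' by (intro encodes_set_union v bu inj_request[OF d]) (auto simp: request_set_def)
  have BX: "B' \<union> B \<subseteq> X" using B B' by blast
  have pos: "Suc k = 0 \<or> 1 \<le> real j * (1 - 1 / \<gamma>) ^ (Suc k - 1)" using nk n1 by simp
  have "greedy_inv d X x j (greedy_step s)"
    unfolding greedy_inv_def step
    by (rule exI[of _ "B' \<union> B"], rule exI[of _ "S' \<union> S"], rule exI[of _ n'],
        rule exI[of _ "Suc k"], rule exI[of _ "tree_diff ru v"],
        rule exI[of _ "tree_union v bu"], rule exI[of _ "tree_union w su"])
      (use size' rest covered BX pos un sol n'_eq cost2 nk' \<open>B' \<noteq> {}\<close> in simp)
  moreover have "length (dec_list (lft (rgt (rgt (greedy_step s))))) < length (dec_list (lft (rgt (rgt s))))"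
    using n'_less unfolding step unfolding s by (simp add: enc_nat_conv_list)
  ultimately show "greedy_inv d X x j (greedy_step s) \<and>
    length (dec_list (lft (rgt (rgt (greedy_step s))))) < length (dec_list (lft (rgt (rgt s))))" by blast
  show "\<exists>d X i u. d \<in> data \<P> \<and> request_set \<P> d X \<and> i \<in> {1..card X} \<and>
      encodes_set (enc_request \<P>) X u \<and>
      Node (lft s) (Node (lft (rgt s)) (lft (rgt (rgt s)))) = Node (enc_data \<P> d) (Node u (enc_nat i))"
    unfolding s using d XB nXB ru
    by (intro exI[of _ d] exI[of _ "X - B"] exI[of _ n] exI[of _ ru]) simp
qed

text \<open>Covered and uncovered requests are subsets of \<open>X\<close>, so their codes are no
  larger than \<open>u\<close>; the resource list is controlled by the budget clause.\<close>

lemma greedy_inv_size: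
  assumes inv: "greedy_inv d X x j s"
  shows "tsize s \<le> 3 * tsize x + tsize x * T (tsize x) + 9"
proof -
  obtain B S n ru bu su where
    s: "s = Node (enc_data \<P> d) (Node ru (Node (enc_nat n) (Node bu su)))" and
    ru: "encodes_set (enc_request \<P>) (X - B) ru" and bu: "encodes_set (enc_request \<P>) B bu" and
    B: "B \<subseteq> X" and n: "n = j - card B" and
    size: "tsize su + n * T (tsize x) \<le> Suc (j * T (tsize x))"
    using inv unfolding greedy_inv_def by blast
  have "tsize ru \<le> tsize u" "tsize bu \<le> tsize u"
    using encodes_set_tsize_mono ru bu u B by blast+
  moreover have "j \<le> tsize x" unfolding x greedy_start_def by (simp add: tsize_enc_nat)
  then have "j * T (tsize x) \<le> tsize x * T (tsize x)" by simp
  moreover have "tsize (enc_data \<P> d) + tsize u + 2 * j \<le> tsize x"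
    unfolding x greedy_start_def by (simp add: tsize_enc_nat)
  moreover have "tsize s = tsize (enc_data \<P> d) + tsize ru + 2 * n + tsize bu + tsize su + 5"
    by (simp add: s tsize_enc_nat)
  moreover have "n \<le> j" using n by simp
  ultimately show ?thesis using size by linarith
qed

text \<open>The factor refers to any \<open>N\<close> above \<open>card X\<close>, so all later
  calls on subsets of the original request set share one factor.\<close>

lemma greedy:
  assumes N: "card X \<le> N"
  shows "\<exists>B S v w. greedy (enc_data \<P> d) u (enc_nat j) = Node v w \<and>
     encodes_set (enc_request \<P>) B v \<and> encodes_set (enc_resource \<P>) S w \<and>
     B \<subseteq> X \<and> solution \<P> d S B \<and> j \<le> card B \<and>
     ennreal (total_cost \<P> d S) \<le> ennreal (gfun \<alpha> \<gamma> (real N)) * min_cost \<P> d X j"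
proof -
  define z where "z = while (\<lambda>s. lft (rgt (rgt s)) \<noteq> Leaf) greedy_step x"
  have "greedy_inv d X x j z \<and> lft (rgt (rgt z)) = Leaf"
    unfolding z_def
    by (rule while_rule[where P = "greedy_inv d X x j"
          and r = "measure (\<lambda>s. length (dec_list (lft (rgt (rgt s)))))"])
      (use greedy_inv_step greedy_inv_start[OF u] x in auto)
  then obtain B S n k ru bu su where
    z': "z = Node (enc_data \<P> d) (Node ru (Node (enc_nat n) (Node bu su)))" "lft (rgt (rgt z)) = Leaf" and
    bu: "encodes_set (enc_request \<P>) B bu" and
    su: "encodes_set (enc_resource \<P>) S su" and B: "B \<subseteq> X" and
    S: "if B = {} then S = {} else solution \<P> d S B" and n': "n = j - card B" and
    cost: "ennreal (total_cost \<P> d S) \<le> ennreal (real k * \<alpha>) * min_cost \<P> d X j" and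
    k: "k = 0 \<or> 1 \<le> real j * (1 - 1 / \<gamma>) ^ (k - 1)"
    unfolding greedy_inv_def by blast
  have n: "j - card B = 0" using z' n' by (simp add: enc_nat_eq_Leaf)
  have z: "rgt (rgt (rgt z)) = Node bu su" using z' by simp
  have "real k * \<alpha> \<le> gfun \<alpha> \<gamma> (real N)"
    using j N by (intro rounds_le_gfun[OF \<alpha> \<gamma> _ _ k]) auto
  then have "ennreal (real k * \<alpha>) * min_cost \<P> d X j \<le> ennreal (gfun \<alpha> \<gamma> (real N)) * min_cost \<P> d X j"
    by (intro mult_right_mono ennreal_leI) auto
  \<comment> \<open>The exit condition gives \<open>j \<le> card B\<close> with
    \<open>j \<ge> 1\<close>. So \<open>B\<close> is nonempty and the exceptional case of the
    invariant is excluded.\<close>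
  moreover have "solution \<P> d S B" using S n j by (auto split: if_splits)
  ultimately show ?thesis
    unfolding greedy_def using z bu su B n order_trans[OF cost] unfolding z_def x
    by (intro exI[of _ B] exI[of _ S]) auto
qed

end

text \<open>The loop invariant \<open>J\<close> remembers which instance is being solved, because
  \<open>F\<close> is known to be fast only on inputs that encode one.\<close>

lemma polytime_greedy:
  "polytime_on (demand_inputs \<P>) (\<lambda>x. greedy (lft x) (lft (rgt x)) (rgt (rgt x)))"
    (is "polytime_on ?D _")
proof -
  define b where "b s \<longleftrightarrow> lft (rgt (rgt s)) \<noteq> Leaf" for s
  define E where "E = {x. \<exists>d X i u. d \<in> data \<P> \<and> request_set \<P> d X \<and> i \<in> {1..card X} \<and>
      encodes_set (enc_request \<P>) X u \<and> x = greedy_start (enc_data \<P> d) u (enc_nat i)}"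
  define J where "J x s \<longleftrightarrow> (\<exists>d X i u. d \<in> data \<P> \<and> request_set \<P> d X \<and> i \<in> {1..card X} \<and>
      encodes_set (enc_request \<P>) X u \<and> x = greedy_start (enc_data \<P> d) u (enc_nat i) \<and>
      greedy_inv d X x i s)" for x s
  define m where "m s = length (dec_list (lft (rgt (rgt s))))" for s
  define I where "I = {s. \<exists>x. J x s}"
  have loop: "polytime_on E (while b greedy_step)"
  proof (rule polytime_while[where J = J and m = m and I = I
        and P = "\<lambda>n. 3 * n + n * T n + 9"])
    show "decidable_on I b"
      unfolding b_def by (intro decidable_nonleaf polytime_intros)
    have dom: "Node (lft s) (Node (lft (rgt s)) (lft (rgt (rgt s)))) \<in> ?D" if "s \<in> {s \<in> I. b s}" for s
    proof -
      obtain x d X i u where "d \<in> data \<P>" "request_set \<P> d X" "encodes_set (enc_request \<P>) X u"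
          "i \<in> {1..card X}" "x = greedy_start (enc_data \<P> d) u (enc_nat i)" "greedy_inv d X x i s"
        using \<open>s \<in> {s \<in> I. b s}\<close> unfolding I_def J_def by blast
      from greedy_inv_step(2)[OF this] show ?thesis
        using \<open>s \<in> {s \<in> I. b s}\<close> unfolding b_def by simp
    qed
    show "polytime_on {s \<in> I. b s} greedy_step"
      unfolding greedy_step_def Let_def
      by (intro polytime_intros polytime_comp[OF poly_F] dom)
    show "poly_bound (\<lambda>n. 3 * n + n * T n + 9)" by (intro poly_bound_intros T)
    show "J x x" if "x \<in> E" for x
      using that greedy_inv_start unfolding E_def J_def by blast
    show "J x (greedy_step s) \<and> m (greedy_step s) < m s" if "J x s" "b s" for x s
    proof -
      obtain d X i u where x: "d \<in> data \<P>" "request_set \<P> d X" "encodes_set (enc_request \<P>) X u"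
          "i \<in> {1..card X}" "x = greedy_start (enc_data \<P> d) u (enc_nat i)" "greedy_inv d X x i s"
        using \<open>J x s\<close> unfolding J_def by blast
      from greedy_inv_step(1)[OF this] show ?thesis
        using \<open>b s\<close> x unfolding J_def b_def m_def by blast
    qed
    show "s \<in> I \<and> tsize s \<le> 3 * tsize x + tsize x * T (tsize x) + 9 \<and>
        m s \<le> 3 * tsize x + tsize x * T (tsize x) + 9" if "J x s" for x s
    proof -
      obtain d X i u where "d \<in> data \<P>" "request_set \<P> d X" "encodes_set (enc_request \<P>) X u"
          "i \<in> {1..card X}" "x = greedy_start (enc_data \<P> d) u (enc_nat i)" "greedy_inv d X x i s"
        using \<open>J x s\<close> unfolding J_def by blast
      from greedy_inv_size[OF this] have "tsize s \<le> 3 * tsize x + tsize x * T (tsize x) + 9" .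
      moreover have "m s \<le> tsize s"
        unfolding m_def using length_dec_list_less_tsize[of "lft (rgt (rgt s))"]
          tsize_lft[of "rgt (rgt s)"] tsize_rgt[of "rgt s"] tsize_rgt[of s] by linarith
      ultimately show ?thesis using that unfolding I_def by auto
    qed
  qed
  have dom: "greedy_start (lft x) (lft (rgt x)) (rgt (rgt x)) \<in> E" if "x \<in> ?D" for x
  proof -
    obtain d X i u where "d \<in> data \<P>" "request_set \<P> d X" "i \<in> {1..card X}"
        "encodes_set (enc_request \<P>) X u" "x = Node (enc_data \<P> d) (Node u (enc_nat i))"
      using \<open>x \<in> ?D\<close> by blast
    then show ?thesis unfolding E_def by (intro CollectI exI conjI) auto
  qed
  have start: "polytime_on ?D (\<lambda>x. greedy_start (lft x) (lft (rgt x)) (rgt (rgt x)))"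
    unfolding greedy_start_def by (intro polytime_intros)
  have "polytime_on ?D (\<lambda>x. while b greedy_step (greedy_start (lft x) (lft (rgt x)) (rgt (rgt x))))"
    by (rule polytime_comp[OF loop start]) (rule dom)
  moreover have "b = (\<lambda>s. lft (rgt (rgt s)) \<noteq> Leaf)"
    unfolding b_def by (rule refl)
  ultimately show ?thesis
    unfolding greedy_def by (intro polytime_rgt) simp
qed

end

section \<open>The partition\<close>

lemma remaining_eq: "remaining Xh X n = Xh - (\<Union>i\<in>{1..n}. X i)"
proof (induction n)
  case (Suc n)
  have "{1..Suc n} = insert (Suc n) {1..n}" by auto
  then show ?case using Suc by auto
qed simp

lemma remaining_cong: "(\<And>i. i \<in> {1..n} \<Longrightarrow> X i = X' i) \<Longrightarrow> remaining Xh X n = remaining Xh X' n"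
  unfolding remaining_eq by simp

text \<open>Each part lies in what its predecessors leave, so the cardinalities telescope.\<close>

lemma half_rest_eq:
  assumes "finite Xh" "1 \<le> i" "\<And>k. k \<in> {1..<i} \<Longrightarrow> X k \<subseteq> remaining Xh X (k - 1)"
  shows "half_rest Xh X i = real (card (remaining Xh X (i - 1))) / 2"
proof -
  have "card (remaining Xh X n) + (\<Sum>k\<in>{1..<Suc n}. card (X k)) = card Xh" if "n < i" for n
    using that
  proof (induction n)
    case (Suc n)
    have sub: "X (Suc n) \<subseteq> remaining Xh X n" using assms(3)[of "Suc n"] Suc.prems by simp
    have fin: "finite (remaining Xh X n)" using assms(1) by (simp add: remaining_eq)
    have "card (remaining Xh X n - X (Suc n)) + card (X (Suc n)) = card (remaining Xh X n)"
      using sub fin by (simp add: card_Diff_subset card_mono finite_subset)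
    then show ?case using Suc by simp
  qed simp
  from this[of "i - 1"] have "card (remaining Xh X (i - 1)) + (\<Sum>k\<in>{1..<i}. card (X k)) = card Xh"
    using assms(2) by simp
  then have "real (card Xh) = real (card (remaining Xh X (i - 1))) + (\<Sum>k\<in>{1..<i}. real (card (X k)))"
    by (simp flip: of_nat_sum of_nat_add)
  then show ?thesis unfolding half_rest_def by simp
qed

text \<open>Matches the ceilings of the specification with the number computed by
  \<open>tree_half\<close>.\<close>

lemma nat_ceiling_half: "nat \<lceil>real n / 2\<rceil> = Suc n div 2"
proof -
  have "\<lceil>real n / 2\<rceil> = int (Suc n div 2)" by (rule ceiling_unique) linarith+
  then show ?thesis by simp
qed

text \<open>The last part comes first, so that steps touch only the head of the list;
  \<open>tree_rev\<close> restores the output order at the end.\<close>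

primrec encodes_stack ::
    "('d, 'q, 's) covering_problem \<Rightarrow> nat \<Rightarrow> (nat \<Rightarrow> 'q set) \<Rightarrow> (nat \<Rightarrow> 's set) \<Rightarrow> tree \<Rightarrow> bool" where
  "encodes_stack \<P> 0 X S y \<longleftrightarrow> y = Leaf"
| "encodes_stack \<P> (Suc n) X S y \<longleftrightarrow> (\<exists>u v z. y = Node (Node u v) z \<and>
     encodes_set (enc_request \<P>) (X (Suc n)) u \<and> encodes_set (enc_resource \<P>) (S (Suc n)) v \<and>
     encodes_stack \<P> n X S z)"

lemma encodes_stack_cong:
  "encodes_stack \<P> n X S y \<Longrightarrow> (\<And>i. i \<in> {1..n} \<Longrightarrow> X i = X' i \<and> S i = S' i) \<Longrightarrow> encodes_stack \<P> n X' S' y"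
proof (induction n arbitrary: y)
  case (Suc n)
  obtain u v z where "y = Node (Node u v) z" "encodes_set (enc_request \<P>) (X (Suc n)) u"
      "encodes_set (enc_resource \<P>) (S (Suc n)) v" "encodes_stack \<P> n X S z"
    using Suc.prems(1) by auto
  moreover have "encodes_stack \<P> n X' S' z" using Suc.IH[OF calculation(4)] Suc.prems(2) by simp
  moreover have "X (Suc n) = X' (Suc n)" "S (Suc n) = S' (Suc n)" using Suc.prems(2) by auto
  ultimately show ?case by auto
qed simp

lemma encodes_stack_length: "encodes_stack \<P> n X S y \<Longrightarrow> length (dec_list y) = n"
  by (induction n arbitrary: y) auto

lemma encodes_parts_tree_rev:
  assumes "encodes_stack \<P> r X S y"
  shows "encodes_parts \<P> r X S (tree_rev y)"
proof -
  have "\<exists>u v. dec_list y = rev (map (\<lambda>i. Node (u i) (v i)) [1..<Suc r]) \<and>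
     (\<forall>i\<in>{1..r}. encodes_set (enc_request \<P>) (X i) (u i) \<and> encodes_set (enc_resource \<P>) (S i) (v i))"
    using assms
  proof (induction r arbitrary: y)
    case (Suc r)
    obtain a b z where y: "y = Node (Node a b) z" "encodes_set (enc_request \<P>) (X (Suc r)) a"
        "encodes_set (enc_resource \<P>) (S (Suc r)) b" "encodes_stack \<P> r X S z"
      using Suc.prems by auto
    obtain u v where uv: "dec_list z = rev (map (\<lambda>i. Node (u i) (v i)) [1..<Suc r])"
        "\<forall>i\<in>{1..r}. encodes_set (enc_request \<P>) (X i) (u i) \<and> encodes_set (enc_resource \<P>) (S i) (v i)"
      using Suc.IH[OF y(4)] by blast
    have "map (\<lambda>i. Node ((u(Suc r := a)) i) ((v(Suc r := b)) i)) [1..<Suc r] = map (\<lambda>i. Node (u i) (v i)) [1..<Suc r]"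
      by (intro map_cong) auto
    then have "dec_list y = rev (map (\<lambda>i. Node ((u(Suc r := a)) i) ((v(Suc r := b)) i)) [1..<Suc (Suc r)])"
      using uv(1) y(1) by simp
    moreover have "\<forall>i\<in>{1..Suc r}. encodes_set (enc_request \<P>) (X i) ((u(Suc r := a)) i) \<and>
        encodes_set (enc_resource \<P>) (S i) ((v(Suc r := b)) i)"
      using uv(2) y(2,3) by (auto simp: le_Suc_eq)
    ultimately show ?case by blast
  qed simp
  then obtain u v where "dec_list y = rev (map (\<lambda>i. Node (u i) (v i)) [1..<Suc r])" and
     "\<forall>i\<in>{1..r}. encodes_set (enc_request \<P>) (X i) (u i) \<and> encodes_set (enc_resource \<P>) (S i) (v i)"
    by blast
  then show ?thesis unfolding encodes_parts_def tree_rev_eq by (metis rev_rev_ident)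
qed

context covering_algorithm
begin

text \<open>\<open>R\<close> is the set of requests left for the \<open>i\<close>-th part \<open>B\<close>, \<open>S'\<close> is the solution of the part before.\<close>

definition part_ok :: "'d \<Rightarrow> nat \<Rightarrow> nat \<Rightarrow> 'q set \<Rightarrow> 's set \<Rightarrow> 'q set \<Rightarrow> 's set \<Rightarrow> bool" where
  "part_ok d N i R S' B S \<longleftrightarrow> B \<subseteq> R \<and> B \<noteq> {} \<and> solution \<P> d S B \<and> card R \<le> 2 * card B \<and>
     (2 \<le> i \<longrightarrow> 10 * total_cost \<P> d S' < total_cost \<P> d S \<longrightarrow>
        ennreal (total_cost \<P> d S) \<le> ennreal (gfun \<alpha> \<gamma> (real N)) * min_cost \<P> d R (Suc (card R) div 2)) \<and>
     ennreal (total_cost \<P> d S) \<le> ennreal (gfun \<alpha> \<gamma> (real N)) *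
       min_cost \<P> d R (if i = 1 then Suc (card R) div 2 else card B)"

text \<open>Condition (B) at index \<open>i\<close>.\<close>

definition jump :: "'d \<Rightarrow> (nat \<Rightarrow> 's set) \<Rightarrow> nat \<Rightarrow> bool" where
  "jump d S i \<longleftrightarrow> (total_cost \<P> d (S i) < 2 * total_cost \<P> d (S (i - 1)) \<longrightarrow>
     8 * total_cost \<P> d (S (i - 1)) < total_cost \<P> d (S (i + 1)))"

text \<open>The strict bound \<open>i + 1 < r\<close> leaves (B) open for the topmost three parts: a
  step may break it there, and the next step tests it.\<close>

definition parts_ok :: "'d \<Rightarrow> 'q set \<Rightarrow> nat \<Rightarrow> (nat \<Rightarrow> 'q set) \<Rightarrow> (nat \<Rightarrow> 's set) \<Rightarrow> bool" where
  "parts_ok d Xh r X S \<longleftrightarrow>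
     (\<forall>i\<in>{1..r}. part_ok d (card Xh) i (remaining Xh X (i - 1)) (S (i - 1)) (X i) (S i)) \<and>
     (\<forall>i. 2 \<le> i \<and> i + 1 < r \<longrightarrow> jump d S i)"

text \<open>Common core of push and merge, the latter first cutting the stack down to height
  \<open>n\<close>. Under a new part the old topmost triple becomes interior, hence the hypothesis
  \<open>jump\<close>.\<close>

lemma parts_ok_extend:
  assumes "parts_ok d Xh n X S" and jump: "\<And>i. 2 \<le> i \<Longrightarrow> i + 1 = n \<Longrightarrow> jump d S i"
    and part: "part_ok d (card Xh) (Suc n) (remaining Xh X n) (S n) B S'"
  shows "parts_ok d Xh (Suc n) (X(Suc n := B)) (S(Suc n := S'))"
  unfolding parts_ok_def
proof (intro conjI ballI allI impI)
  fix i assume i: "i \<in> {1..Suc n}"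
  have rem: "remaining Xh (X(Suc n := B)) (i - 1) = remaining Xh X (i - 1)"
    using i by (intro remaining_cong) auto
  show "part_ok d (card Xh) i (remaining Xh (X(Suc n := B)) (i - 1)) ((S(Suc n := S')) (i - 1))
      ((X(Suc n := B)) i) ((S(Suc n := S')) i)"
    unfolding rem using i part assms(1) unfolding parts_ok_def by (cases "i = Suc n") auto
next
  fix i assume "2 \<le> i \<and> i + 1 < Suc n"
  then have "jump d S i" using assms(1) jump unfolding parts_ok_def by (cases "i + 1 = n") auto
  then show "jump d (S(Suc n := S')) i"
    using \<open>2 \<le> i \<and> i + 1 < Suc n\<close> unfolding jump_def by auto
qed

text \<open>The cost bound for half of the remaining requests is (C) itself. Since \<open>B\<close>
  has at least that many elements, it also yields (D) by monotonicity in the number covered.\<close>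

lemma parts_ok_push:
  assumes d: "d \<in> data \<P>" and Xh: "request_set \<P> d Xh"
    and ok: "parts_ok d Xh n X S" and jump: "\<And>i. 2 \<le> i \<Longrightarrow> i + 1 = n \<Longrightarrow> jump d S i"
    and B: "B \<subseteq> remaining Xh X n" "solution \<P> d S' B" "Suc (card (remaining Xh X n)) div 2 \<le> card B"
      "remaining Xh X n \<noteq> {}"
    and cost: "ennreal (total_cost \<P> d S') \<le> ennreal (gfun \<alpha> \<gamma> (real (card Xh))) *
      min_cost \<P> d (remaining Xh X n) (Suc (card (remaining Xh X n)) div 2)"
  shows "parts_ok d Xh (Suc n) (X(Suc n := B)) (S(Suc n := S'))"
proof (rule parts_ok_extend[OF ok jump])
  have R: "request_set \<P> d (remaining Xh X n)" using Xh unfolding remaining_eq request_set_def by auto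
  have "0 < card (remaining Xh X n)" using R B(4) unfolding request_set_def by (simp add: card_gt_0_iff)
  then have "B \<noteq> {}" using B(3) by auto
  moreover have "ennreal (total_cost \<P> d S') \<le> ennreal (gfun \<alpha> \<gamma> (real (card Xh))) *
      min_cost \<P> d (remaining Xh X n) (card B)"
    using cost min_cost_mono_card[OF d R B(3)] by (blast intro: order_trans mult_left_mono zero_le)
  ultimately show "part_ok d (card Xh) (Suc n) (remaining Xh X n) (S n) B S'"
    unfolding part_ok_def using B cost by auto
qed

text \<open>The instance of (B) that ends at index \<open>n\<close> is interior in the old stack and
  thus known; those involving the new part may stay open. With \<open>1 \<le> n\<close> the new part
  is not the first one, so (D) is asked in its form with \<open>card B\<close>.\<close>

lemma parts_ok_merge:
  assumes d: "d \<in> data \<P>" and Xh: "request_set \<P> d Xh"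
    and ok: "parts_ok d Xh (Suc (Suc n)) X S" and n: "1 \<le> n" and no_jump: "\<not> jump d S (Suc n)"
    and B: "B \<subseteq> remaining Xh X n" "solution \<P> d S' B" "card (X (Suc n) \<union> X (Suc (Suc n))) \<le> card B"
    and cost: "total_cost \<P> d S' \<le> total_cost \<P> d (S (Suc n) \<union> S (Suc (Suc n)))"
      "ennreal (total_cost \<P> d S') \<le> ennreal (gfun \<alpha> \<gamma> (real (card Xh))) *
         min_cost \<P> d (remaining Xh X n) (card (X (Suc n) \<union> X (Suc (Suc n))))"
  shows "parts_ok d Xh (Suc n) (X(Suc n := B)) (S(Suc n := S'))"
proof (rule parts_ok_extend)
  show "parts_ok d Xh n X S" using ok unfolding parts_ok_def by auto
  show "jump d S i" if "2 \<le> i" "i + 1 = n" for i using ok that unfolding parts_ok_def by auto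
  have R: "request_set \<P> d (remaining Xh X n)" using Xh unfolding remaining_eq request_set_def by auto
  have p1: "part_ok d (card Xh) (Suc n) (remaining Xh X n) (S n) (X (Suc n)) (S (Suc n))"
    using bspec[OF conjunct1[OF ok[unfolded parts_ok_def]], of "Suc n"] by simp
  have p2: "part_ok d (card Xh) (Suc (Suc n)) (remaining Xh X (Suc n)) (S (Suc n)) (X (Suc (Suc n))) (S (Suc (Suc n)))"
    using bspec[OF conjunct1[OF ok[unfolded parts_ok_def]], of "Suc (Suc n)"] by simp
  have V: "X (Suc n) \<union> X (Suc (Suc n)) \<subseteq> remaining Xh X n"
    using p1 p2 unfolding part_ok_def by auto
  then have fin: "finite (X (Suc n) \<union> X (Suc (Suc n)))"
    using R unfolding request_set_def by (auto intro: finite_subset)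
  then have card: "card (X (Suc n)) \<le> card B" using B(3) card_mono[OF fin, of "X (Suc n)"] by simp
  have "X (Suc n) \<noteq> {}" using p1 unfolding part_ok_def by blast
  then have "B \<noteq> {}" using card fin by auto
  have "total_cost \<P> d S' \<le> total_cost \<P> d (S (Suc n)) + total_cost \<P> d (S (Suc (Suc n)))"
    using cost(1) total_cost_union[OF d] p1 p2 unfolding part_ok_def solution_def
    by (meson order_trans)
  moreover have "total_cost \<P> d (S (Suc n)) < 2 * total_cost \<P> d (S n)"
    "total_cost \<P> d (S (Suc (Suc n))) \<le> 8 * total_cost \<P> d (S n)"
    using no_jump unfolding jump_def by auto
  ultimately have C: "\<not> 10 * total_cost \<P> d (S n) < total_cost \<P> d S'" by linarith
  have "ennreal (total_cost \<P> d S') \<le> ennreal (gfun \<alpha> \<gamma> (real (card Xh))) *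
      min_cost \<P> d (remaining Xh X n) (card B)"
    using cost(2) min_cost_mono_card[OF d R B(3)] by (blast intro: order_trans mult_left_mono zero_le)
  moreover have "card (remaining Xh X n) \<le> 2 * card B"
    using p1 card unfolding part_ok_def by linarith
  ultimately show "part_ok d (card Xh) (Suc n) (remaining Xh X n) (S n) B S'"
    unfolding part_ok_def using B(1,2) C \<open>B \<noteq> {}\<close> n by auto
qed

text \<open>A state \<open>Node d (Node R z)\<close> holds the remaining requests \<open>R\<close> and the stack \<open>z\<close> of the parts
  found so far, the most recent one on top.\<close>

definition violated :: "tree \<Rightarrow> bool" where
  "violated s \<longleftrightarrow> (let d = lft s; z = rgt (rgt s); S2 = rgt (lft z); S1 = rgt (lft (rgt z));
      S0 = rgt (lft (rgt (rgt z)))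
    in rgt (rgt z) \<noteq> Leaf \<and> K 1 2 (Node d (Node S1 S0)) \<noteq> Leaf \<and> \<not> K 8 1 (Node d (Node S0 S2)) \<noteq> Leaf)"

definition push :: "tree \<Rightarrow> tree" where
  "push s = (let d = lft s; R = lft (rgt s); z = rgt (rgt s); y = greedy d R (tree_half R)
    in Node d (Node (tree_diff R (lft y)) (Node y z)))"

text \<open>\<open>R'\<close> restores the requests that were available before the two top parts
  were taken. On a tie the union is kept, and then the remaining requests do not change.\<close>

definition merge :: "tree \<Rightarrow> tree" where
  "merge s = (let d = lft s; R = lft (rgt s); z = rgt (rgt s);
      V = tree_union (lft (lft z)) (lft (lft (rgt z)));
      U = tree_union (rgt (lft z)) (rgt (lft (rgt z)));
      R' = tree_union R V; y = greedy d R' (tree_card V)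
    in if K 1 1 (Node d (Node (rgt y) U)) \<noteq> Leaf
       then Node d (Node (tree_diff R' (lft y)) (Node y (rgt (rgt z))))
       else Node d (Node R (Node (Node V U) (rgt (rgt z)))))"

definition main_step :: "tree \<Rightarrow> tree" where
  "main_step s = (if violated s then merge s else push s)"

text \<open>A violation has to be repaired even when no request is left, since (B) reaches up to the
  last part.\<close>

definition running :: "tree \<Rightarrow> bool" where
  "running s \<longleftrightarrow> violated s \<or> lft (rgt s) \<noteq> Leaf"

definition main_start :: "tree \<Rightarrow> tree" where
  "main_start x = Node (lft x) (Node (rgt x) Leaf)"

text \<open>The weight 2 of a request pays for the part that a push adds. A merge removes one part
  and leaves no more requests than before, as the replacement covers at least as many.\<close>

definition main_measure :: "tree \<Rightarrow> nat" where
  "main_measure s = 2 * length (dec_list (lft (rgt s))) + length (dec_list (rgt (rgt s)))"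

definition main_inv :: "'d \<Rightarrow> 'q set \<Rightarrow> tree \<Rightarrow> bool" where
  "main_inv d Xh s \<longleftrightarrow> (\<exists>r X S u z. s = Node (enc_data \<P> d) (Node u z) \<and>
     encodes_set (enc_request \<P>) (remaining Xh X r) u \<and> encodes_stack \<P> r X S z \<and>
     parts_ok d Xh r X S)"

lemma main_invI:
  "s = Node (enc_data \<P> d) (Node u z) \<Longrightarrow> encodes_set (enc_request \<P>) (remaining Xh X r) u \<Longrightarrow>
   encodes_stack \<P> r X S z \<Longrightarrow> parts_ok d Xh r X S \<Longrightarrow> main_inv d Xh s"
  unfolding main_inv_def by blast

lemma main_invE:
  assumes "main_inv d Xh s"
  obtains r X S u z where "s = Node (enc_data \<P> d) (Node u z)"
    "encodes_set (enc_request \<P>) (remaining Xh X r) u" "encodes_stack \<P> r X S z" "parts_ok d Xh r X S"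
  using assms unfolding main_inv_def by blast

section \<open>Correctness of the main loop\<close>

lemma main_inv_start:
  assumes "encodes_set (enc_request \<P>) Xh u"
  shows "main_inv d Xh (main_start (Node (enc_data \<P> d) u))"
  by (rule main_invI[where r = 0]) (use assms in \<open>auto simp: main_start_def parts_ok_def\<close>)

lemma parts_ok_resource_set: "parts_ok d Xh r X S \<Longrightarrow> i \<in> {1..r} \<Longrightarrow> resource_set \<P> d (S i)"
  unfolding parts_ok_def part_ok_def solution_def by blast

lemma encodes_stackE:
  assumes "encodes_stack \<P> r X S z" "rgt (rgt z) \<noteq> Leaf"
  obtains n u2 v2 u1 v1 u0 v0 y where "r = Suc (Suc (Suc n))"
    "z = Node (Node u2 v2) (Node (Node u1 v1) (Node (Node u0 v0) y))"
    "encodes_set (enc_request \<P>) (X (Suc (Suc (Suc n)))) u2" "encodes_set (enc_resource \<P>) (S (Suc (Suc (Suc n)))) v2"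
    "encodes_set (enc_request \<P>) (X (Suc (Suc n))) u1" "encodes_set (enc_resource \<P>) (S (Suc (Suc n))) v1"
    "encodes_set (enc_resource \<P>) (S (Suc n)) v0"
    "encodes_stack \<P> (Suc n) X S (Node (Node u0 v0) y)"
proof -
  have "length (dec_list z) = r" using assms(1) by (rule encodes_stack_length)
  moreover have "2 < length (dec_list z)"
    using assms(2) by (cases z; cases "rgt z"; cases "rgt (rgt z)") auto
  ultimately obtain n where "r = Suc (Suc (Suc n))"
    by (metis add_2_eq_Suc less_imp_Suc_add)
  then show thesis using assms(1) that by auto
qed

lemma violated_iff:
  assumes d: "d \<in> data \<P>" and s: "s = Node (enc_data \<P> d) (Node u z)"
    and z: "encodes_stack \<P> r X S z" and ok: "parts_ok d Xh r X S"
  shows "violated s \<longleftrightarrow> 3 \<le> r \<and> \<not> jump d S (r - 1)"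
proof (cases "rgt (rgt z) = Leaf")
  case True
  have "length (dec_list z) = r" using z by (rule encodes_stack_length)
  then have "r < 3" using True by (cases z; cases "rgt z"; cases "rgt (rgt z)") auto
  then show ?thesis using True by (simp add: violated_def s)
next
  case False
  obtain n u2 v2 u1 v1 u0 v0 y where r: "r = Suc (Suc (Suc n))" and
    z': "z = Node (Node u2 v2) (Node (Node u1 v1) (Node (Node u0 v0) y))" and
    v: "encodes_set (enc_resource \<P>) (S (Suc (Suc (Suc n)))) v2"
      "encodes_set (enc_resource \<P>) (S (Suc (Suc n))) v1" "encodes_set (enc_resource \<P>) (S (Suc n)) v0"
    by (rule encodes_stackE[OF z False]) blast
  have res: "resource_set \<P> d (S (Suc (Suc (Suc n))))" "resource_set \<P> d (S (Suc (Suc n)))"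
      "resource_set \<P> d (S (Suc n))"
    using parts_ok_resource_set[OF ok] r by auto
  show ?thesis
    using K[OF d res(2,3) v(2,3), of 1 2] K[OF d res(3,1) v(3,1), of 8 1]
    by (auto simp: violated_def s z' r jump_def)
qed

text \<open>Guarantees that both cost comparisons of the test are admissible queries, as needed for
  its running time.\<close>

lemma violated_inputs:
  assumes d: "d \<in> data \<P>" and inv: "main_inv d Xh s" and z: "rgt (rgt (rgt (rgt s))) \<noteq> Leaf"
  shows "Node (lft s) (Node (rgt (lft (rgt (rgt (rgt s))))) (rgt (lft (rgt (rgt (rgt (rgt s))))))) \<in> comparison_inputs \<P>"
    and "Node (lft s) (Node (rgt (lft (rgt (rgt (rgt (rgt s)))))) (rgt (lft (rgt (rgt s))))) \<in> comparison_inputs \<P>"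
proof -
  obtain r X S u z where s: "s = Node (enc_data \<P> d) (Node u z)" and
    z': "encodes_stack \<P> r X S z" and ok: "parts_ok d Xh r X S"
    using inv by (rule main_invE) blast
  have "rgt (rgt z) \<noteq> Leaf" using z s by simp
  obtain n u2 v2 u1 v1 u0 v0 y where r: "r = Suc (Suc (Suc n))" and
    z: "z = Node (Node u2 v2) (Node (Node u1 v1) (Node (Node u0 v0) y))" and
    v: "encodes_set (enc_resource \<P>) (S (Suc (Suc (Suc n)))) v2"
      "encodes_set (enc_resource \<P>) (S (Suc (Suc n))) v1" "encodes_set (enc_resource \<P>) (S (Suc n)) v0"
    by (rule encodes_stackE[OF z' \<open>rgt (rgt z) \<noteq> Leaf\<close>]) blast
  have res: "resource_set \<P> d (S (Suc (Suc (Suc n))))" "resource_set \<P> d (S (Suc (Suc n)))"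
      "resource_set \<P> d (S (Suc n))"
    using parts_ok_resource_set[OF ok] r by auto
  show "Node (lft s) (Node (rgt (lft (rgt (rgt (rgt s))))) (rgt (lft (rgt (rgt (rgt (rgt s))))))) \<in> comparison_inputs \<P>"
    unfolding s z using d res v by simp blast
  show "Node (lft s) (Node (rgt (lft (rgt (rgt (rgt (rgt s)))))) (rgt (lft (rgt (rgt s))))) \<in> comparison_inputs \<P>"
    unfolding s z using d res v by simp blast
qed

context
  fixes d :: 'd and Xh :: "'q set" and u :: tree and q :: nat
  assumes d: "d \<in> data \<P>" and Xh: "request_set \<P> d Xh" and u: "encodes_set (enc_request \<P>) Xh u"
    and q: "\<forall>R v n. R \<subseteq> Xh \<longrightarrow> encodes_set (enc_request \<P>) R v \<longrightarrow> n \<in> {1..card R} \<longrightarrow>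
      tsize (greedy (enc_data \<P> d) v (enc_nat n)) \<le> q"
begin

text \<open>\<open>q\<close> bounds all greedy answers on subsets of \<open>Xh\<close>, so the
  growth of the state per step does not depend on the state. The last claim makes the greedy call
  admissible.\<close>

lemma push_correct:
  assumes inv: "main_inv d Xh s" and ready: "\<not> violated s" "lft (rgt s) \<noteq> Leaf"
  shows "main_inv d Xh (push s)" "main_measure (push s) < main_measure s"
    "tsize (push s) \<le> tsize s + (tsize u + q + 1)"
    "Node (lft s) (Node (lft (rgt s)) (tree_half (lft (rgt s)))) \<in> demand_inputs \<P>"
proof -
  obtain r X S ru z where s: "s = Node (enc_data \<P> d) (Node ru z)" and
    ru: "encodes_set (enc_request \<P>) (remaining Xh X r) ru" and
    z: "encodes_stack \<P> r X S z" and ok: "parts_ok d Xh r X S"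
    using inv by (rule main_invE)
  define R where "R = remaining Xh X r"
  define j where "j = Suc (card R) div 2"
  have R: "R \<subseteq> Xh" "request_set \<P> d R" "card R \<le> card Xh"
    using Xh unfolding R_def remaining_eq request_set_def by (auto intro: card_mono)
  have "R \<noteq> {}" using ready(2) ru unfolding s R_def by auto
  then have "0 < card R" using R unfolding request_set_def by (simp add: card_gt_0_iff)
  then have j: "j \<in> {1..card R}" unfolding j_def by auto
  have half: "tree_half ru = enc_nat j" unfolding tree_half_eq j_def encodes_set_card[OF ru] R_def ..
  obtain B S' v w where y: "greedy (enc_data \<P> d) ru (enc_nat j) = Node v w"
    and v: "encodes_set (enc_request \<P>) B v" and w: "encodes_set (enc_resource \<P>) S' w"
    and B: "B \<subseteq> R" "solution \<P> d S' B" "j \<le> card B"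
    and cost: "ennreal (total_cost \<P> d S') \<le> ennreal (gfun \<alpha> \<gamma> (real (card Xh))) * min_cost \<P> d R j"
    using greedy[OF d R(2) ru[folded R_def] j refl R(3)] by blast
  have step: "push s = Node (enc_data \<P> d) (Node (tree_diff ru v) (Node (Node v w) z))"
    unfolding push_def Let_def s by (simp add: half y)
  have ru': "encodes_set (enc_request \<P>) (R - B) (tree_diff ru v)"
    using R B by (intro encodes_set_diff ru[folded R_def] v inj_request[OF d]) (auto simp: request_set_def)
  define X' where "X' = X(Suc r := B)"
  define S'' where "S'' = S(Suc r := S')"
  have rem: "remaining Xh X' (Suc r) = R - B"
    using remaining_cong[of r "X(Suc r := B)" X] unfolding X'_def R_def by simp
  \<comment> \<open>The assumptions force height at least 3, so the failed test gives (B) at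
    \<open>r - 1\<close>, which is \<open>i\<close>.\<close>
  have jump: "jump d S i" if "2 \<le> i" "i + 1 = r" for i
    using violated_iff[OF d s z ok] ready(1) that by (auto simp flip: that(2))
  have ok': "parts_ok d Xh (Suc r) X' S''"
    unfolding X'_def S''_def
    using B cost \<open>R \<noteq> {}\<close> unfolding R_def j_def by (intro parts_ok_push[OF d Xh ok jump])
  have z': "encodes_stack \<P> (Suc r) X' S'' (Node (Node v w) z)"
    using v w encodes_stack_cong[OF z, of X' S''] by (simp add: X'_def S''_def)
  show "main_inv d Xh (push s)"
    by (rule main_invI[OF step _ z' ok']) (use rem ru' in simp)
  have "card (R - B) < card R"
    using B j R(2) unfolding request_set_def by (simp add: card_Diff_subset finite_subset)
  then show "main_measure (push s) < main_measure s"
    unfolding step unfolding s main_measure_def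
    by (simp add: encodes_set_card[OF ru'] encodes_set_card[OF ru[folded R_def]])
  have "tsize (tree_diff ru v) \<le> tsize u" using encodes_set_tsize_mono[OF ru' u] R by blast
  moreover have "tsize (Node v w) \<le> q" using q[rule_format, OF R(1) ru[folded R_def] j] unfolding y .
  ultimately show "tsize (push s) \<le> tsize s + (tsize u + q + 1)" unfolding step unfolding s by simp
  show "Node (lft s) (Node (lft (rgt s)) (tree_half (lft (rgt s)))) \<in> demand_inputs \<P>"
    unfolding s using d R(2) j ru half R_def by auto
qed

lemma merge_correct:
  assumes inv: "main_inv d Xh s" and viol: "violated s"
  defines "V \<equiv> tree_union (lft (lft (rgt (rgt s)))) (lft (lft (rgt (rgt (rgt s)))))"
  defines "U \<equiv> tree_union (rgt (lft (rgt (rgt s)))) (rgt (lft (rgt (rgt (rgt s)))))"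
  defines "R' \<equiv> tree_union (lft (rgt s)) V"
  shows "main_inv d Xh (merge s)" "main_measure (merge s) < main_measure s"
    "tsize (merge s) \<le> tsize s + (tsize u + q + 1)"
    "Node (lft s) (Node R' (tree_card V)) \<in> demand_inputs \<P>"
    "Node (lft s) (Node (rgt (greedy (lft s) R' (tree_card V))) U) \<in> comparison_inputs \<P>"
proof -
  obtain r X S ru z where s: "s = Node (enc_data \<P> d) (Node ru z)" and
    ru: "encodes_set (enc_request \<P>) (remaining Xh X r) ru" and
    z: "encodes_stack \<P> r X S z" and ok: "parts_ok d Xh r X S"
    using inv by (rule main_invE)
  have no_jump: "\<not> jump d S (r - 1)" using violated_iff[OF d s z ok] viol by blast
  have "rgt (rgt z) \<noteq> Leaf" using viol unfolding violated_def s by (simp add: Let_def)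
  obtain m u2 v2 u1 v1 u0 v0 y0 where r: "r = Suc (Suc (Suc m))" and
    z_eq: "z = Node (Node u2 v2) (Node (Node u1 v1) (Node (Node u0 v0) y0))" and
    u2: "encodes_set (enc_request \<P>) (X (Suc (Suc (Suc m)))) u2" and
    v2: "encodes_set (enc_resource \<P>) (S (Suc (Suc (Suc m)))) v2" and
    u1: "encodes_set (enc_request \<P>) (X (Suc (Suc m))) u1" and
    v1: "encodes_set (enc_resource \<P>) (S (Suc (Suc m))) v1" and
    rest: "encodes_stack \<P> (Suc m) X S (Node (Node u0 v0) y0)"
    by (rule encodes_stackE[OF z \<open>rgt (rgt z) \<noteq> Leaf\<close>])
  define n where "n = Suc m"
  note r = r[folded n_def] and u2 = u2[folded n_def] and v2 = v2[folded n_def]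
    and u1 = u1[folded n_def] and v1 = v1[folded n_def] and rest = rest[folded n_def]
  define y where "y = Node (Node u0 v0) y0"
  note z_eq = z_eq[folded y_def] and rest = rest[folded y_def]
  define R where "R = remaining Xh X n"
  define X12 where "X12 = X (Suc (Suc n)) \<union> X (Suc n)"
  define S12 where "S12 = S (Suc (Suc n)) \<union> S (Suc n)"
  have R: "R \<subseteq> Xh" "request_set \<P> d R" "card R \<le> card Xh"
    using Xh unfolding R_def remaining_eq request_set_def by (auto intro: card_mono)
  have p1: "part_ok d (card Xh) (Suc n) (remaining Xh X n) (S n) (X (Suc n)) (S (Suc n))"
    using bspec[OF conjunct1[OF ok[unfolded parts_ok_def]], of "Suc n"] r by simp
  have p2: "part_ok d (card Xh) (Suc (Suc n)) (remaining Xh X (Suc n)) (S (Suc n)) (X (Suc (Suc n))) (S (Suc (Suc n)))"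
    using bspec[OF conjunct1[OF ok[unfolded parts_ok_def]], of "Suc (Suc n)"] r by simp
  have X12: "X12 \<subseteq> R" "X12 \<noteq> {}"
    using p1 p2 unfolding part_ok_def X12_def R_def by auto
  have rem: "remaining Xh X r = R - X12" unfolding r R_def X12_def by auto
  have parts: "request_set \<P> d (X (Suc n))" "request_set \<P> d (X (Suc (Suc n)))"
    using X12 R(2) unfolding X12_def request_set_def by (auto intro: finite_subset)
  have sol: "solution \<P> d (S (Suc n)) (X (Suc n))" "solution \<P> d (S (Suc (Suc n))) (X (Suc (Suc n)))"
    using p1 p2 unfolding part_ok_def by auto
  have sol12: "solution \<P> d S12 X12"
    unfolding S12_def X12_def by (rule solution_union[OF d parts(2,1) sol(2,1)])
  have res12: "resource_set \<P> d S12" using sol12 unfolding solution_def by simp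
  have V_eq: "V = tree_union u2 u1" and U_eq: "U = tree_union v2 v1" and R'_eq: "R' = tree_union ru V"
    unfolding V_def U_def R'_def s z_eq by simp_all
  have V: "encodes_set (enc_request \<P>) X12 V"
    unfolding V_eq X12_def using parts by (intro encodes_set_union u2 u1 inj_request[OF d]) (auto simp: request_set_def)
  have U: "encodes_set (enc_resource \<P>) S12 U"
    unfolding U_eq S12_def using sol
    by (intro encodes_set_union v2 v1 inj_resource[OF d]) (auto simp: solution_def resource_set_def)
  have R': "encodes_set (enc_request \<P>) R R'"
  proof -
    have "encodes_set (enc_request \<P>) (R - X12 \<union> X12) R'"
      unfolding R'_eq using R(2) X12
      by (intro encodes_set_union ru[unfolded rem] V inj_request[OF d]) (auto simp: request_set_def)
    then show ?thesis using X12(1) by (simp add: Un_absorb2)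
  qed
  have finR: "finite R" using R(2) unfolding request_set_def by simp
  have "0 < card X12" using X12 finR by (simp add: card_gt_0_iff finite_subset)
  then have j: "card X12 \<in> {1..card R}" using X12 finR by (auto intro: card_mono)
  have cardV: "tree_card V = enc_nat (card X12)" unfolding tree_card_eq encodes_set_card[OF V] ..
  obtain B S' v w where gr: "greedy (enc_data \<P> d) R' (enc_nat (card X12)) = Node v w"
    and v: "encodes_set (enc_request \<P>) B v" and w: "encodes_set (enc_resource \<P>) S' w"
    and B: "B \<subseteq> R" "solution \<P> d S' B" "card X12 \<le> card B"
    and cost: "ennreal (total_cost \<P> d S') \<le> ennreal (gfun \<alpha> \<gamma> (real (card Xh))) * min_cost \<P> d R (card X12)"
    using greedy[OF d R(2) R' j refl R(3)] by blast
  have res': "resource_set \<P> d S'" using B(2) unfolding solution_def by simp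
  have cmp: "K 1 1 (Node (enc_data \<P> d) (Node w U)) \<noteq> Leaf \<longleftrightarrow> total_cost \<P> d S' < total_cost \<P> d S12"
    using K[OF d res' res12 w U, of 1 1] by simp
  have merge_eq: "merge s = (if total_cost \<P> d S' < total_cost \<P> d S12
      then Node (enc_data \<P> d) (Node (tree_diff R' v) (Node (Node v w) y))
      else Node (enc_data \<P> d) (Node ru (Node (Node V U) y)))"
    unfolding merge_def Let_def s z_eq using gr cmp[symmetric] cardV
    by (simp flip: V_eq U_eq R'_eq)
  show "Node (lft s) (Node R' (tree_card V)) \<in> demand_inputs \<P>"
    unfolding cardV using d R(2) j R' by (auto simp: s)
  show "Node (lft s) (Node (rgt (greedy (lft s) R' (tree_card V))) U) \<in> comparison_inputs \<P>"
    unfolding cardV using d res' res12 w U gr by (auto simp: s)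

  have no_jump': "\<not> jump d S (Suc n)" using no_jump unfolding r by simp
  have swap: "X (Suc n) \<union> X (Suc (Suc n)) = X12" "S (Suc n) \<union> S (Suc (Suc n)) = S12"
    unfolding X12_def S12_def by auto
  \<comment> \<open>Treats both candidates at once: the pair \<open>C\<close>, \<open>D\<close> will
    be the greedy cover or the union of the two old parts.\<close>
  have result: "main_inv d Xh (Node (enc_data \<P> d) (Node a (Node (Node b c) y)))"
    if C: "C \<subseteq> R" "solution \<P> d D C" "card X12 \<le> card C"
      and cost: "total_cost \<P> d D \<le> total_cost \<P> d S12"
        "ennreal (total_cost \<P> d D) \<le> ennreal (gfun \<alpha> \<gamma> (real (card Xh))) * min_cost \<P> d R (card X12)"
      and abc: "encodes_set (enc_request \<P>) (R - C) a" "encodes_set (enc_request \<P>) C b"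
        "encodes_set (enc_resource \<P>) D c"
    for C D a b c
  proof (rule main_invI[OF refl])
    show "parts_ok d Xh (Suc n) (X(Suc n := C)) (S(Suc n := D))"
      using C cost swap n_def unfolding R_def
      by (intro parts_ok_merge[OF d Xh ok[unfolded r] _ no_jump']) simp_all
    show "encodes_set (enc_request \<P>) (remaining Xh (X(Suc n := C)) (Suc n)) a"
      using abc(1) remaining_cong[of n "X(Suc n := C)" X] unfolding R_def by simp
    show "encodes_stack \<P> (Suc n) (X(Suc n := C)) (S(Suc n := D)) (Node (Node b c) y)"
      using abc(2,3) encodes_stack_cong[OF rest, of "X(Suc n := C)" "S(Suc n := D)"] by simp
  qed
  have card_ru: "length (dec_list ru) = card R - card X12"
    using encodes_set_card[OF ru] X12(1) finR unfolding rem by (simp add: card_Diff_subset finite_subset)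
  have Rv: "encodes_set (enc_request \<P>) (R - B) (tree_diff R' v)"
    using R B by (intro encodes_set_diff R' v inj_request[OF d]) (auto simp: request_set_def)
  show "main_inv d Xh (merge s)"
  proof (cases "total_cost \<P> d S' < total_cost \<P> d S12")
    case True
    then show ?thesis unfolding merge_eq using result[OF B _ cost Rv v w] by simp
  next
    case False
    \<comment> \<open>The union is no dearer than the greedy cover and so inherits its
      bound.\<close>
    then have "ennreal (total_cost \<P> d S12) \<le> ennreal (total_cost \<P> d S')" by (intro ennreal_leI) simp
    then have "ennreal (total_cost \<P> d S12) \<le>
        ennreal (gfun \<alpha> \<gamma> (real (card Xh))) * min_cost \<P> d R (card X12)"
      using cost by (rule order_trans)
    then show ?thesis unfolding merge_eq using False
      result[OF X12(1) sol12 order_refl order_refl _ ru[unfolded rem] V U] by simp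
  qed
  show "main_measure (merge s) < main_measure s"
  proof (cases "total_cost \<P> d S' < total_cost \<P> d S12")
    case True
    have "length (dec_list (tree_diff R' v)) = card R - card B"
      using encodes_set_card[OF Rv] B(1) finR by (simp add: card_Diff_subset finite_subset)
    then show ?thesis using True B(3) card_ru unfolding merge_eq unfolding main_measure_def s z_eq by simp
  next
    case False
    then show ?thesis unfolding merge_eq unfolding main_measure_def s z_eq by simp
  qed
  show "tsize (merge s) \<le> tsize s + (tsize u + q + 1)"
  proof (cases "total_cost \<P> d S' < total_cost \<P> d S12")
    case True
    have "tsize (tree_diff R' v) \<le> tsize u" using encodes_set_tsize_mono[OF Rv u] R by blast
    moreover have "tsize (Node v w) \<le> q" using q[rule_format, OF R(1) R' j] unfolding gr .
    ultimately show ?thesis using True unfolding merge_eq unfolding s z_eq by simp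
  next
    case False
    have "tsize V \<le> tsize u2 + tsize u1" "tsize U \<le> tsize v2 + tsize v1"
      using encodes_set_tsize_union[OF u2 u1 V[unfolded X12_def]]
        encodes_set_tsize_union[OF v2 v1 U[unfolded S12_def]] by auto
    then show ?thesis using False unfolding merge_eq unfolding s z_eq by simp
  qed
qed

lemma main_step_correct:
  assumes "main_inv d Xh s" "running s"
  shows "main_inv d Xh (main_step s)" "main_measure (main_step s) < main_measure s"
    "tsize (main_step s) \<le> tsize s + (tsize u + q + 1)"
  using merge_correct(1-3)[OF assms(1)] push_correct(1-3)[OF assms(1)] assms(2)
  unfolding main_step_def running_def by auto

end

text \<open>All queries consist of the data, a subset of \<open>Xh\<close> and a demand of at most
  its size. In unary the demand has about twice that size, so a query is at most three times as
  large as the original input.\<close>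

lemma greedy_size_bound:
  obtains G where "poly_bound G"
    "\<And>d Xh u. d \<in> data \<P> \<Longrightarrow> request_set \<P> d Xh \<Longrightarrow> encodes_set (enc_request \<P>) Xh u \<Longrightarrow>
      \<forall>R v n. R \<subseteq> Xh \<longrightarrow> encodes_set (enc_request \<P>) R v \<longrightarrow> n \<in> {1..card R} \<longrightarrow>
      tsize (greedy (enc_data \<P> d) v (enc_nat n)) \<le> G (tsize (Node (enc_data \<P> d) u))"
proof -
  obtain G where G: "poly_bound G" and bound: "\<And>x. x \<in> demand_inputs \<P> \<Longrightarrow>
      tsize (greedy (lft x) (lft (rgt x)) (rgt (rgt x))) \<le> G (tsize x)"
    by (rule polytime_on_size[OF polytime_greedy]) blast
  have "tsize (greedy (enc_data \<P> d) v (enc_nat n)) \<le> G (3 * tsize (Node (enc_data \<P> d) u))"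
    if "d \<in> data \<P>" "request_set \<P> d Xh" "encodes_set (enc_request \<P>) Xh u" "R \<subseteq> Xh"
      "encodes_set (enc_request \<P>) R v" "n \<in> {1..card R}" for d Xh u R v n
  proof -
    let ?x = "Node (enc_data \<P> d) (Node v (enc_nat n))"
    have "request_set \<P> d R" using that(2,4) unfolding request_set_def by (auto intro: finite_subset)
    then have "?x \<in> demand_inputs \<P>" using that by blast
    then have "tsize (greedy (enc_data \<P> d) v (enc_nat n)) \<le> G (tsize ?x)" using bound by fastforce
    also have "\<dots> \<le> G (3 * tsize (Node (enc_data \<P> d) u))"
    proof (rule poly_bound_mono[OF G])
      have "tsize v \<le> tsize u" by (rule encodes_set_tsize_mono[OF that(5,3,4)])
      moreover have "n \<le> tsize v"
        using encodes_set_card[OF that(5)] length_dec_list_less_tsize[of v] that(6) by simp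
      ultimately show "tsize ?x \<le> 3 * tsize (Node (enc_data \<P> d) u)" by (simp add: tsize_enc_nat)
    qed
    finally show ?thesis .
  qed
  moreover have "poly_bound (\<lambda>n. G (3 * n))"
    by (intro poly_bound_comp[OF G] poly_bound_intros)
  ultimately show thesis using that[of "\<lambda>n. G (3 * n)"] by blast
qed

text \<open>On exit no request is left and no violation is present. The latter supplies the instance
  of (B) for the topmost triple that \<open>parts_ok\<close> leaves open.\<close>

lemma main_result:
  assumes d: "d \<in> data \<P>" and Xh: "request_set \<P> d Xh" and u: "encodes_set (enc_request \<P>) Xh u"
  defines "y \<equiv> tree_rev (rgt (rgt (while running main_step (main_start (Node (enc_data \<P> d) u)))))"
  shows "\<exists>r X S. encodes_parts \<P> r X S y \<and> parts_ok d Xh r X S \<and> remaining Xh X r = {} \<and>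
    (\<forall>i. 2 \<le> i \<and> i + 1 \<le> r \<longrightarrow> jump d S i)"
proof -
  define s where "s = while running main_step (main_start (Node (enc_data \<P> d) u))"
  obtain G where G: "\<And>d Xh u. d \<in> data \<P> \<Longrightarrow> request_set \<P> d Xh \<Longrightarrow>
      encodes_set (enc_request \<P>) Xh u \<Longrightarrow>
      \<forall>R v n. R \<subseteq> Xh \<longrightarrow> encodes_set (enc_request \<P>) R v \<longrightarrow> n \<in> {1..card R} \<longrightarrow>
      tsize (greedy (enc_data \<P> d) v (enc_nat n)) \<le> G (tsize (Node (enc_data \<P> d) u))"
    by (rule greedy_size_bound) blast
  note step = main_step_correct[OF d Xh u G[OF d Xh u]]
  have "main_inv d Xh s \<and> \<not> running s"
    unfolding s_def
    by (rule while_rule[where P = "main_inv d Xh" and r = "measure main_measure"])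
      (use step(1,2) main_inv_start[OF u] in auto)
  then obtain r X S ru z where s_eq: "s = Node (enc_data \<P> d) (Node ru z)" and
    ru: "encodes_set (enc_request \<P>) (remaining Xh X r) ru" and
    z: "encodes_stack \<P> r X S z" and ok: "parts_ok d Xh r X S" and stop: "\<not> running s"
    by (elim conjE main_invE)
  have "ru = Leaf" "\<not> violated s" using stop unfolding running_def by (auto simp: s_eq)
  then have rem: "remaining Xh X r = {}" using ru by simp
  have "jump d S i" if "2 \<le> i" "i + 1 \<le> r" for i
  proof (cases "i + 1 = r")
    case True
    then show ?thesis using violated_iff[OF d s_eq z ok] \<open>\<not> violated s\<close> that by (auto simp flip: True)
  next
    case False
    then show ?thesis using ok that unfolding parts_ok_def by auto
  qed
  moreover have "encodes_parts \<P> r X S y"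
    using encodes_parts_tree_rev[OF z] s_eq unfolding y_def s_def by simp
  ultimately show ?thesis using ok rem by blast
qed

lemma polytime_main:
  "polytime_on {x. \<exists>d Xh u. d \<in> data \<P> \<and> request_set \<P> d Xh \<and> encodes_set (enc_request \<P>) Xh u \<and>
      x = Node (enc_data \<P> d) u}
    (\<lambda>x. tree_rev (rgt (rgt (while running main_step (main_start x)))))"
    (is "polytime_on ?D _")
proof -
  obtain G where "poly_bound G" and G: "\<And>d Xh u. d \<in> data \<P> \<Longrightarrow> request_set \<P> d Xh \<Longrightarrow>
      encodes_set (enc_request \<P>) Xh u \<Longrightarrow>
      \<forall>R v n. R \<subseteq> Xh \<longrightarrow> encodes_set (enc_request \<P>) R v \<longrightarrow> n \<in> {1..card R} \<longrightarrow>
      tsize (greedy (enc_data \<P> d) v (enc_nat n)) \<le> G (tsize (Node (enc_data \<P> d) u))"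
    by (rule greedy_size_bound) blast
  \<comment> \<open>Bounds the growth of the state in one step, in terms of the size of the initial
    state.\<close>
  define Q where "Q n = n + G n + 1" for n
  define E where "E = main_start ` ?D"
  \<comment> \<open>The potential, size plus \<open>Q\<close> times the measure, never increases: a
    step adds at most \<open>Q\<close> to the size and lowers the measure by at least one.\<close>
  define J where "J x s \<longleftrightarrow> (\<exists>d Xh u. d \<in> data \<P> \<and> request_set \<P> d Xh \<and>
      encodes_set (enc_request \<P>) Xh u \<and> x = main_start (Node (enc_data \<P> d) u) \<and> main_inv d Xh s \<and>
      main_measure s \<le> main_measure x \<and>
      tsize s + main_measure s * Q (tsize x) \<le> tsize x + main_measure x * Q (tsize x))" for x s
  define I where "I = {s. \<exists>d Xh u. d \<in> data \<P> \<and> request_set \<P> d Xh \<and>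
      encodes_set (enc_request \<P>) Xh u \<and> main_inv d Xh s}"
  have Q: "poly_bound Q"
    unfolding Q_def by (intro poly_bound_intros \<open>poly_bound G\<close>)
  have K_dec: "decidable_on (comparison_inputs \<P>) (\<lambda>x. K a b x \<noteq> Leaf)" for a b
    by (rule decidable_nonleaf[OF poly_K])
  have greedy_comp: "polytime_on A (\<lambda>x. greedy (f x) (g x) (h x))"
    if "polytime_on A f" "polytime_on A g" "polytime_on A h"
      "\<And>x. x \<in> A \<Longrightarrow> Node (f x) (Node (g x) (h x)) \<in> demand_inputs \<P>" for A f g h
    using polytime_comp[OF polytime_greedy polytime_Node[OF that(1) polytime_Node[OF that(2,3)]] that(4)]
    by simp
  have violated: "decidable_on I violated"
    unfolding violated_def Let_def
  \<comment> \<open>Each conjunct is decided only where the earlier ones hold. The height test comes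
    first and ensures that the three solutions to be compared exist.\<close>
  proof (intro decidable_conj)
    show "decidable_on I (\<lambda>s. rgt (rgt (rgt (rgt s))) \<noteq> Leaf)"
      by (intro decidable_nonleaf polytime_intros)
  next
    show "decidable_on {s \<in> I. rgt (rgt (rgt (rgt s))) \<noteq> Leaf} (\<lambda>s. K 1 2 (Node (lft s)
        (Node (rgt (lft (rgt (rgt (rgt s))))) (rgt (lft (rgt (rgt (rgt (rgt s)))))))) \<noteq> Leaf)"
      by (rule decidable_comp[OF K_dec], intro polytime_intros)
        (use violated_inputs(1) in \<open>unfold I_def, blast\<close>)
  next
    show "decidable_on {s \<in> {s \<in> I. rgt (rgt (rgt (rgt s))) \<noteq> Leaf}. K 1 2 (Node (lft s)
        (Node (rgt (lft (rgt (rgt (rgt s))))) (rgt (lft (rgt (rgt (rgt (rgt s)))))))) \<noteq> Leaf}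
      (\<lambda>s. \<not> K 8 1 (Node (lft s)
        (Node (rgt (lft (rgt (rgt (rgt (rgt s)))))) (rgt (lft (rgt (rgt s)))))) \<noteq> Leaf)"
      by (rule decidable_not[OF decidable_comp[OF K_dec]], intro polytime_intros)
        (use violated_inputs(2) in \<open>unfold I_def, blast\<close>)
  qed
  have running: "decidable_on I running"
    unfolding running_def
    by (intro decidable_disj violated decidable_nonleaf polytime_intros)
  have push_inputs: "Node (lft s) (Node (lft (rgt s)) (tree_half (lft (rgt s)))) \<in> demand_inputs \<P>"
    if s: "s \<in> {s \<in> {s \<in> I. running s}. \<not> violated s}" for s
  proof -
    obtain d Xh u where dXu: "d \<in> data \<P>" "request_set \<P> d Xh" "encodes_set (enc_request \<P>) Xh u"
      and inv: "main_inv d Xh s" using s unfolding I_def by blast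
    from push_correct(4)[OF dXu G[OF dXu] inv] s show ?thesis unfolding running_def by blast
  qed
  have push: "polytime_on {s \<in> {s \<in> I. running s}. \<not> violated s} push"
    unfolding push_def Let_def by (intro polytime_intros greedy_comp push_inputs)
  define M where "M = {s \<in> {s \<in> I. running s}. violated s}"
  have merge_inputs:
    "Node (lft s) (Node (tree_union (lft (rgt s))
        (tree_union (lft (lft (rgt (rgt s)))) (lft (lft (rgt (rgt (rgt s)))))))
      (tree_card (tree_union (lft (lft (rgt (rgt s)))) (lft (lft (rgt (rgt (rgt s))))))))
      \<in> demand_inputs \<P>" (is ?demand)
    "Node (lft s) (Node (rgt (greedy (lft s)
        (tree_union (lft (rgt s)) (tree_union (lft (lft (rgt (rgt s)))) (lft (lft (rgt (rgt (rgt s)))))))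
        (tree_card (tree_union (lft (lft (rgt (rgt s)))) (lft (lft (rgt (rgt (rgt s)))))))))
      (tree_union (rgt (lft (rgt (rgt s)))) (rgt (lft (rgt (rgt (rgt s)))))))
      \<in> comparison_inputs \<P>" (is ?comparison)
    if s: "s \<in> M" for s
  proof -
    obtain d Xh u where dXu: "d \<in> data \<P>" "request_set \<P> d Xh" "encodes_set (enc_request \<P>) Xh u"
      and inv: "main_inv d Xh s" using s unfolding M_def I_def by blast
    have "violated s" using s unfolding M_def by blast
    show ?demand ?comparison
      using merge_correct(4,5)[OF dXu G[OF dXu] inv \<open>violated s\<close>] .
  qed
  have merge_greedy: "polytime_on A (\<lambda>s. greedy (lft s)
      (tree_union (lft (rgt s)) (tree_union (lft (lft (rgt (rgt s)))) (lft (lft (rgt (rgt (rgt s)))))))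
      (tree_card (tree_union (lft (lft (rgt (rgt s)))) (lft (lft (rgt (rgt (rgt s))))))))"
    if "A \<subseteq> M" for A
    by (intro greedy_comp polytime_intros merge_inputs(1)) (use that in blast)
  have merge: "polytime_on {s \<in> {s \<in> I. running s}. violated s} merge"
    unfolding merge_def Let_def M_def[symmetric]
    by (intro polytime_if decidable_comp[OF K_dec] polytime_intros merge_greedy
        merge_inputs(2)) auto
  have loop: "polytime_on E (while running main_step)"
  proof (rule polytime_while[where J = J and m = main_measure and I = I
        and P = "\<lambda>n. 3 * n + (2 * n) * Q n"])
    show "decidable_on I running" by (rule running)
    show "polytime_on {s \<in> I. running s} main_step"
      unfolding main_step_def
      by (intro polytime_if merge push decidable_on_subset[OF violated]) blast
    show "poly_bound (\<lambda>n. 3 * n + (2 * n) * Q n)" by (intro poly_bound_intros Q)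
    show "J x x" if x: "x \<in> E" for x
    proof -
      obtain d Xh u where dXu: "d \<in> data \<P>" "request_set \<P> d Xh" "encodes_set (enc_request \<P>) Xh u"
        and x: "x = main_start (Node (enc_data \<P> d) u)" using x unfolding E_def by blast
      show ?thesis unfolding J_def using dXu x main_inv_start[OF dXu(3)] by blast
    qed
    show "J x (main_step s) \<and> main_measure (main_step s) < main_measure s" if J: "J x s" "running s" for x s
    proof -
      obtain d Xh u where dXu: "d \<in> data \<P>" "request_set \<P> d Xh" "encodes_set (enc_request \<P>) Xh u"
        and x: "x = main_start (Node (enc_data \<P> d) u)" and inv: "main_inv d Xh s"
        and m: "main_measure s \<le> main_measure x"
        and size: "tsize s + main_measure s * Q (tsize x) \<le> tsize x + main_measure x * Q (tsize x)"
        using J(1) unfolding J_def by blast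
      note step = main_step_correct[OF dXu G[OF dXu] inv J(2)]
      have "tsize (Node (enc_data \<P> d) u) \<le> tsize x" unfolding x main_start_def by simp
      then have "tsize u + G (tsize (Node (enc_data \<P> d) u)) + 1 \<le> Q (tsize x)"
        unfolding Q_def using poly_bound_mono[OF \<open>poly_bound G\<close>] by (intro add_mono) auto
      moreover have "Suc (main_measure (main_step s)) * Q (tsize x) \<le> main_measure s * Q (tsize x)"
        using step(2) by (intro mult_le_mono1) simp
      ultimately have "tsize (main_step s) + main_measure (main_step s) * Q (tsize x)
          \<le> tsize x + main_measure x * Q (tsize x)"
        using step(3) size unfolding mult_Suc by linarith
      then show ?thesis unfolding J_def using dXu x step(1,2) m
        by (intro conjI exI[of _ d] exI[of _ Xh] exI[of _ u]) auto
    qed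
    show "s \<in> I \<and> tsize s \<le> 3 * tsize x + (2 * tsize x) * Q (tsize x) \<and>
        main_measure s \<le> 3 * tsize x + (2 * tsize x) * Q (tsize x)" if x: "x \<in> E" and J: "J x s" for x s
    proof -
      \<comment> \<open>The stack is empty at the start, so the measure is twice the number of
        requests.\<close>
      have m: "main_measure x \<le> 2 * tsize x"
        using x length_dec_list_less_tsize unfolding E_def main_start_def main_measure_def
        by (auto simp: less_imp_le trans_le_add2 le_SucI)
      then have "main_measure x * Q (tsize x) \<le> (2 * tsize x) * Q (tsize x)" by (rule mult_le_mono1)
      moreover have "s \<in> I" "main_measure s \<le> main_measure x"
        "tsize s + main_measure s * Q (tsize x) \<le> tsize x + main_measure x * Q (tsize x)"
        using J unfolding J_def I_def by blast+
      ultimately show ?thesis using m by linarith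
    qed
  qed
  have start: "polytime_on ?D main_start"
    unfolding main_start_def by (intro polytime_intros)
  have "polytime_on ?D (\<lambda>x. while running main_step (main_start x))"
    by (rule polytime_comp[OF loop start]) (simp add: E_def)
  then show ?thesis by (intro polytime_intros)
qed

lemma parts_ok_partition:
  assumes Xh: "request_set \<P> d Xh" and ok: "parts_ok d Xh r X S" and rem: "remaining Xh X r = {}"
  shows "indexed_partition Xh r X"
  unfolding indexed_partition_def
proof (intro conjI ballI)
  have part: "X i \<subseteq> Xh - (\<Union>k\<in>{1..i - 1}. X k)" "X i \<noteq> {}" if "i \<in> {1..r}" for i
    using ok that unfolding parts_ok_def part_ok_def remaining_eq by blast+
  show "(\<Union>i\<in>{1..r}. X i) = Xh" using part(1) rem unfolding remaining_eq by blast
  show "X i \<noteq> {}" if "i \<in> {1..r}" for i by (rule part(2)[OF that])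
  have "X i \<inter> X j = {}" if "i \<in> {1..r}" "j \<in> {1..r}" "i < j" for i j
  proof -
    have "i \<in> {1..j - 1}" using that by auto
    then show ?thesis using part(1)[OF that(2)] by blast
  qed
  then show "disjoint_family_on X {1..r}"
    unfolding disjoint_family_on_def by (metis inf_commute linorder_neqE_nat)
qed

end

theorem theorem2p2:
  fixes \<P> :: "('d, 'q, 's) covering_problem" and \<alpha> \<gamma> :: real
  assumes "covering_problem \<P>"
    and "polytime_comparable_costs \<P>"
    and "efficiently_decomposable \<P> \<alpha> \<gamma>"
  shows "polytime_solvable
    (\<lambda>(d, Xh) x. d \<in> data \<P> \<and> request_set \<P> d Xh \<and>
       (\<exists>u. encodes_set (enc_request \<P>) Xh u \<and> x = Node (enc_data \<P> d) u))
    (\<lambda>(d, Xh) y. \<exists>r X S.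
       encodes_parts \<P> r X S y \<and>
       indexed_partition Xh r X \<and>
       (\<forall>i\<in>{1..r}. solution \<P> d (S i) (X i)) \<and>
       (\<forall>i\<in>{1..r}. real (card (X i)) \<ge> half_rest Xh X i) \<and>
       (\<forall>i. 1 \<le> i - 1 \<and> i + 1 \<le> r \<longrightarrow>
          total_cost \<P> d (S i) < 2 * total_cost \<P> d (S (i - 1)) \<longrightarrow>
          8 * total_cost \<P> d (S (i - 1)) < total_cost \<P> d (S (i + 1))) \<and>
       (\<forall>i. 1 \<le> i - 1 \<and> i \<le> r \<longrightarrow>
          total_cost \<P> d (S i) > 10 * total_cost \<P> d (S (i - 1)) \<longrightarrow>
          ennreal (total_cost \<P> d (S i)) \<le>
            ennreal (gfun \<alpha> \<gamma> (real (card Xh))) *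
            min_cost \<P> d (remaining Xh X (i - 1)) (nat \<lceil>half_rest Xh X i\<rceil>)) \<and>
       (\<forall>i\<in>{1..r}.
          ennreal (total_cost \<P> d (S i)) \<le>
            ennreal (gfun \<alpha> \<gamma> (real (card Xh))) *
            (if i = 1 then min_cost \<P> d (remaining Xh X 0) (nat \<lceil>real (card Xh) / 2\<rceil>)
             else min_cost \<P> d (remaining Xh X (i - 1)) (card (X i)))))"
proof -
  have \<alpha>: "1 \<le> \<alpha>" and \<gamma>: "1 \<le> \<gamma>" using assms(3) unfolding efficiently_decomposable_def by auto
  obtain F where poly_F: "polytime_on (demand_inputs \<P>) F" and
    F: "\<And>d X i u. d \<in> data \<P> \<Longrightarrow> request_set \<P> d X \<Longrightarrow> i \<in> {1..card X} \<Longrightarrow>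
          encodes_set (enc_request \<P>) X u \<Longrightarrow>
          \<exists>B S v w. F (Node (enc_data \<P> d) (Node u (enc_nat i))) = Node v w \<and>
            encodes_set (enc_request \<P>) B v \<and> encodes_set (enc_resource \<P>) S w \<and>
            B \<subseteq> X \<and> solution \<P> d S B \<and>
            ennreal (total_cost \<P> d S) \<le> ennreal \<alpha> * min_cost \<P> d X i \<and>
            real i / \<gamma> \<le> real (card B)"
  proof -
    obtain F where F: "polytime_on {x. \<exists>p. (\<lambda>(d, X, i) x. d \<in> data \<P> \<and> request_set \<P> d X \<and>
          i \<in> {1..card X} \<and>
          (\<exists>u. encodes_set (enc_request \<P>) X u \<and> x = Node (enc_data \<P> d) (Node u (enc_nat i)))) p x} F"
      and "\<forall>p x. (\<lambda>(d, X, i) x. d \<in> data \<P> \<and> request_set \<P> d X \<and> i \<in> {1..card X} \<and>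
          (\<exists>u. encodes_set (enc_request \<P>) X u \<and> x = Node (enc_data \<P> d) (Node u (enc_nat i)))) p x \<longrightarrow>
        (\<lambda>(d, X, i) y. \<exists>B S u v. y = Node u v \<and> encodes_set (enc_request \<P>) B u \<and>
          encodes_set (enc_resource \<P>) S v \<and> B \<subseteq> X \<and> solution \<P> d S B \<and>
          ennreal (total_cost \<P> d S) \<le> ennreal \<alpha> * min_cost \<P> d X i \<and> real i / \<gamma> \<le> real (card B)) p (F x)"
      using assms(3) unfolding efficiently_decomposable_def polytime_solvable_iff by blast
    then have F2: "\<exists>B S v w. F (Node (enc_data \<P> d) (Node u (enc_nat i))) = Node v w \<and>
            encodes_set (enc_request \<P>) B v \<and> encodes_set (enc_resource \<P>) S w \<and>
            B \<subseteq> X \<and> solution \<P> d S B \<and>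
            ennreal (total_cost \<P> d S) \<le> ennreal \<alpha> * min_cost \<P> d X i \<and>
            real i / \<gamma> \<le> real (card B)"
      if "d \<in> data \<P>" "request_set \<P> d X" "i \<in> {1..card X}" "encodes_set (enc_request \<P>) X u" for d X i u
      using that by (elim allE[of _ "(d, X, i)"] allE[of _ "Node (enc_data \<P> d) (Node u (enc_nat i))"])
        (simp only: prod.case, blast)
    have "polytime_on (demand_inputs \<P>) F"
      by (rule polytime_on_subset[OF F]) (simp only: split_paired_Ex prod.case, blast)
    then show thesis using F2 by (rule that)
  qed
  obtain T where T: "poly_bound T" and size_F: "\<And>x. x \<in> demand_inputs \<P> \<Longrightarrow> tsize (F x) \<le> T (tsize x)"
    by (rule polytime_on_size[OF poly_F]) blast
  \<comment> \<open>Running time and correctness are bundled into one predicate, so that a single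
    choice over all \<open>a\<close> and \<open>b\<close> gives the family \<open>K\<close>.\<close>
  define compares where "compares a b f \<longleftrightarrow> polytime_on (comparison_inputs \<P>) f \<and>
      (\<forall>d S S' u v. d \<in> data \<P> \<longrightarrow> resource_set \<P> d S \<longrightarrow> resource_set \<P> d S' \<longrightarrow>
        encodes_set (enc_resource \<P>) S u \<longrightarrow> encodes_set (enc_resource \<P>) S' v \<longrightarrow>
        (f (Node (enc_data \<P> d) (Node u v)) \<noteq> Leaf \<longleftrightarrow>
         real a * total_cost \<P> d S < real b * total_cost \<P> d S'))" for a b :: nat and f
  have "\<forall>a b. \<exists>f. compares a b f"
  proof (intro allI)
    fix a b :: nat
    obtain f where f: "polytime_on {x. \<exists>p. (\<lambda>(d, S, T) x. d \<in> data \<P> \<and> resource_set \<P> d S \<and>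
           resource_set \<P> d T \<and>
           (\<exists>u v. encodes_set (enc_resource \<P>) S u \<and> encodes_set (enc_resource \<P>) T v \<and>
                  x = Node (enc_data \<P> d) (Node u v))) p x} f"
      and "\<forall>p x. (\<lambda>(d, S, T) x. d \<in> data \<P> \<and> resource_set \<P> d S \<and> resource_set \<P> d T \<and>
           (\<exists>u v. encodes_set (enc_resource \<P>) S u \<and> encodes_set (enc_resource \<P>) T v \<and>
                  x = Node (enc_data \<P> d) (Node u v))) p x \<longrightarrow>
         (\<lambda>(d, S, T) y. y = enc_bool (real a * total_cost \<P> d S < real b * total_cost \<P> d T)) p (f x)"
      using assms(2)[unfolded polytime_comparable_costs_def, rule_format, of a b, unfolded polytime_solvable_iff]
      by blast
    then have f2: "f (Node (enc_data \<P> d) (Node u v)) =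
         enc_bool (real a * total_cost \<P> d S < real b * total_cost \<P> d T)"
      if "d \<in> data \<P>" "resource_set \<P> d S" "resource_set \<P> d T"
        "encodes_set (enc_resource \<P>) S u" "encodes_set (enc_resource \<P>) T v" for d S T u v
      using that by (elim allE[of _ "(d, S, T)"] allE[of _ "Node (enc_data \<P> d) (Node u v)"])
        (simp only: prod.case, blast)
    have "polytime_on (comparison_inputs \<P>) f"
      by (rule polytime_on_subset[OF f]) (simp only: split_paired_Ex prod.case, blast)
    then have "compares a b f"
      unfolding compares_def using f2 by (simp add: enc_bool_def split: if_splits)
    then show "\<exists>f. compares a b f" by blast
  qed
  then obtain K where compares: "\<And>a b. compares a b (K a b)" by metis
  have poly_K: "\<And>a b. polytime_on (comparison_inputs \<P>) (K a b)" and
    K: "\<And>a b d S S' u v. d \<in> data \<P> \<Longrightarrow> resource_set \<P> d S \<Longrightarrow> resource_set \<P> d S' \<Longrightarrow>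
          encodes_set (enc_resource \<P>) S u \<Longrightarrow> encodes_set (enc_resource \<P>) S' v \<Longrightarrow>
          K a b (Node (enc_data \<P> d) (Node u v)) \<noteq> Leaf \<longleftrightarrow>
            real a * total_cost \<P> d S < real b * total_cost \<P> d S'"
    using compares unfolding compares_def by blast+
  interpret covering_algorithm \<P> \<alpha> \<gamma> F T K
  proof (unfold_locales, fact assms(1), fact \<alpha>, fact \<gamma>, fact poly_F)
    show "tsize (F (Node (enc_data \<P> d) (Node u (enc_nat i))))
        \<le> T (tsize (Node (enc_data \<P> d) (Node u (enc_nat i))))"
      if "d \<in> data \<P>" "request_set \<P> d X" "i \<in> {1..card X}" "encodes_set (enc_request \<P>) X u" for d X i u
      using that by (intro size_F) blast
  qed (fact F T poly_K K)+
  show ?thesis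
    unfolding polytime_solvable_iff
  proof (intro exI conjI allI impI)
    show "polytime_on {x. \<exists>a. (case a of (d, Xh) \<Rightarrow> \<lambda>x. d \<in> data \<P> \<and> request_set \<P> d Xh \<and>
       (\<exists>u. encodes_set (enc_request \<P>) Xh u \<and> x = Node (enc_data \<P> d) u)) x}
      (\<lambda>x. tree_rev (rgt (rgt (while running main_step (main_start x)))))"
      by (rule polytime_on_subset[OF polytime_main]) auto
  next
    fix a x
    assume "(case a of (d, Xh) \<Rightarrow> \<lambda>x. d \<in> data \<P> \<and> request_set \<P> d Xh \<and>
       (\<exists>u. encodes_set (enc_request \<P>) Xh u \<and> x = Node (enc_data \<P> d) u)) x"
    then obtain d Xh u where a: "a = (d, Xh)" and d: "d \<in> data \<P>" and Xh: "request_set \<P> d Xh"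
      and u: "encodes_set (enc_request \<P>) Xh u" and x: "x = Node (enc_data \<P> d) u"
      by (cases a) auto
    define y where "y = tree_rev (rgt (rgt (while running main_step (main_start x))))"
    obtain r X S where enc: "encodes_parts \<P> r X S y" and ok: "parts_ok d Xh r X S"
      and rem: "remaining Xh X r = {}" and jump: "\<And>i. 2 \<le> i \<Longrightarrow> i + 1 \<le> r \<Longrightarrow> jump d S i"
      using main_result[OF d Xh u] unfolding y_def x by blast
    have part: "part_ok d (card Xh) i (remaining Xh X (i - 1)) (S (i - 1)) (X i) (S i)"
      if "i \<in> {1..r}" for i
      using ok that unfolding parts_ok_def by blast
    have half: "half_rest Xh X i = real (card (remaining Xh X (i - 1))) / 2" if "i \<in> {1..r}" for i
      using Xh that part unfolding request_set_def part_ok_def by (intro half_rest_eq) auto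
    show "(case a of (d, Xh) \<Rightarrow> \<lambda>y. \<exists>r X S.
       encodes_parts \<P> r X S y \<and>
       indexed_partition Xh r X \<and>
       (\<forall>i\<in>{1..r}. solution \<P> d (S i) (X i)) \<and>
       (\<forall>i\<in>{1..r}. real (card (X i)) \<ge> half_rest Xh X i) \<and>
       (\<forall>i. 1 \<le> i - 1 \<and> i + 1 \<le> r \<longrightarrow>
          total_cost \<P> d (S i) < 2 * total_cost \<P> d (S (i - 1)) \<longrightarrow>
          8 * total_cost \<P> d (S (i - 1)) < total_cost \<P> d (S (i + 1))) \<and>
       (\<forall>i. 1 \<le> i - 1 \<and> i \<le> r \<longrightarrow>
          total_cost \<P> d (S i) > 10 * total_cost \<P> d (S (i - 1)) \<longrightarrow>
          ennreal (total_cost \<P> d (S i)) \<le>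
            ennreal (gfun \<alpha> \<gamma> (real (card Xh))) *
            min_cost \<P> d (remaining Xh X (i - 1)) (nat \<lceil>half_rest Xh X i\<rceil>)) \<and>
       (\<forall>i\<in>{1..r}.
          ennreal (total_cost \<P> d (S i)) \<le>
            ennreal (gfun \<alpha> \<gamma> (real (card Xh))) *
            (if i = 1 then min_cost \<P> d (remaining Xh X 0) (nat \<lceil>real (card Xh) / 2\<rceil>)
             else min_cost \<P> d (remaining Xh X (i - 1)) (card (X i)))))
      (tree_rev (rgt (rgt (while running main_step (main_start x)))))"
      unfolding a prod.case y_def[symmetric]
    proof (rule exI[of _ r], rule exI[of _ X], rule exI[of _ S], intro conjI ballI allI impI)
      show "encodes_parts \<P> r X S y" by (rule enc)
      show "indexed_partition Xh r X" by (rule parts_ok_partition[OF Xh ok rem])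
    next
      fix i assume i: "i \<in> {1..r}"
      show "solution \<P> d (S i) (X i)" using part[OF i] unfolding part_ok_def by blast
      show "half_rest Xh X i \<le> real (card (X i))"
        using part[OF i] unfolding part_ok_def half[OF i] by linarith
      show "ennreal (total_cost \<P> d (S i)) \<le>
            ennreal (gfun \<alpha> \<gamma> (real (card Xh))) *
            (if i = 1 then min_cost \<P> d (remaining Xh X 0) (nat \<lceil>real (card Xh) / 2\<rceil>)
             else min_cost \<P> d (remaining Xh X (i - 1)) (card (X i)))"
        using part[OF i] unfolding part_ok_def nat_ceiling_half by (cases "i = 1") auto
    next
      fix i assume i: "1 \<le> i - 1 \<and> i + 1 \<le> r"
        and "total_cost \<P> d (S i) < 2 * total_cost \<P> d (S (i - 1))"
      moreover have "2 \<le> i" "i + 1 \<le> r" using i by auto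
      ultimately show "8 * total_cost \<P> d (S (i - 1)) < total_cost \<P> d (S (i + 1))"
        using jump[of i] unfolding jump_def by blast
    next
      fix i assume i: "1 \<le> i - 1 \<and> i \<le> r"
        and big: "total_cost \<P> d (S i) > 10 * total_cost \<P> d (S (i - 1))"
      have i': "i \<in> {1..r}" "2 \<le> i" using i by auto
      show "ennreal (total_cost \<P> d (S i)) \<le> ennreal (gfun \<alpha> \<gamma> (real (card Xh))) *
            min_cost \<P> d (remaining Xh X (i - 1)) (nat \<lceil>half_rest Xh X i\<rceil>)"
        using part[OF i'(1)] i'(2) big unfolding part_ok_def half[OF i'(1)] nat_ceiling_half by blast
    qed
  qed
qed

end
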